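(* Let $\mathscr L$ be a nondegenerate tropical line bundle on a real torus with integral structure $X=N_{\mathbb R}/\Lambda$ of dimension $g$, with first Chern class $c_1(\mathscr L)=E\in H^{1,1}(X)=(\Lambda\otimes N)^*$. Let $F_{E_X}:H^{\bullet,\bullet}(X)\to H^{\bullet,\bullet}(\widehat X)$ be the Fourier--Mukai transform on tropical cohomology and $\phi_{\mathscr L}:X\to\widehat X$, $\bar x\mapsto t_{\bar x}^*\mathscr L\otimes\mathscr L^{-1}$, the homomorphism attached to $\mathscr L$. Then for every $0\le p\le g$ the following equality holds in $H^{g-p,g-p}(\widehat X)$ (with rational coefficients): $$F_{E_X}\left(\frac{c_1(\mathscr L^{\cdot p})}{p!}\right)=\frac{(-1)^{g-p}}{\det E}\,\phi_{\mathscr L*}\left(\frac{c_1(\mathscr L^{\cdot (g-p)})}{(g-p)!}\right).$$ Here $c_1(\mathscr L^{\cdot k}):=c_1(\mathscr L)^{\wedge k}$ is the $k$-fold cup power.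
   Context: For a lattice (finitely generated free abelian group) $M$ write $M_{\mathbb R}=M\otimes_{\mathbb Z}\mathbb R$, $M^*=\mathrm{Hom}(M,\mathbb Z)$. A real torus with integral structure of dimension $g$ is $X=N_{\mathbb R}/\Lambda$, where $N$ is a lattice of rank $g$ (giving the integral affine structure) and $\Lambda\subset N_{\mathbb R}$ is a second lattice of full rank $g$, so $\Lambda_{\mathbb R}=N_{\mathbb R}$. Its dual is $\widehat X=\Lambda^*_{\mathbb R}/N^*$ (integral structure given by $\Lambda^*$, and $N^*\subset N^*_{\mathbb R}=\Lambda^*_{\mathbb R}$). Line bundles: tropical line bundles on $X$ (torsors under the sheaf $\mathrm{Aff}_X$ of integral affine functions) are, up to isomorphism, the $\mathscr L(E,l)$ with $l\in\mathrm{Hom}(\Lambda,\mathbb R)$ and $E$ a symmetric bilinear form on $N_{\mathbb R}$ with $E(\Lambda\times N)\subseteq\mathbb Z$, and $c_1(\mathscr L(E,l))=E\in\Lambda^*\otimes N^*=H^{1,1}(X)$. $\mathscr L$ is nondegenerate if $E$ is a nondegenerate form. $\widehat X$ is identified with the group $\mathrm{Pic}^0(X)$ of line bundles with trivial first Chern class (class of $l\in\Lambda_{\mathbb R}^*$ $\leftrightarrow\mathscr L(0,l)$); $t_{\bar x}$ is translation by $\bar x$. The map $\phi_{\mathscr L}$ is induced by the linear map $\Phi_E:N_{\mathbb R}\to\Lambda^*_{\mathbb R}$, $x\mapsto-E(-,x)$, which maps $N$ to $\Lambda^*$ and $\Lambda$ to $N^*$. Tropical (co)homology: $H^{p,q}(X)=\bigwedge^q\Lambda^*\otimes\bigwedge^pN^*$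 and $H_{p,q}(X)=\bigwedge^q\Lambda\otimes\bigwedge^pN$, with cup product $(\alpha\otimes\omega)\smile(\beta\otimes\xi)=(\alpha\wedge\beta)\otimes(\omega\wedge\xi)$; for $\widehat X$ replace $(\Lambda,N)$ by $(N^*,\Lambda^* )$, so $H^{p,q}(\widehat X)=\bigwedge^qN\otimes\bigwedge^p\Lambda$. Fix bases $\{\lambda_i\}_{i=1}^g$ of $\Lambda$ and $\{\eta_i\}_{i=1}^g$ of $N$ inducing the same orientation of $N_{\mathbb R}$, with dual bases $\{\lambda_i^*\},\{\eta_i^*\}$. Then $\det E:=\det\big(E(\lambda_i,\eta_j)\big)_{i,j}$. Let $\delta:H^{\bullet,\bullet}(X)\to H^{g,g}(X)\cong\mathbb Z$ be projection to bidegree $(g,g)$ followed by $(\lambda_1^*\wedge\dots\wedge\lambda_g^* )\otimes(\eta_1^*\wedge\dots\wedge\eta_g^* )\mapsto1$; for $\widehat X$ the normalisation is analogous with the bases $\{\eta_i^*\}$ of $N^*$ and $\{\lambda_i^*\}$ of $\Lambda^*$. Poincaré duality $H^{p,q}(X)\xrightarrow{\sim}H_{g-p,g-q}(X)=H^{g-p,g-q}(X)^*$ sends $x$ to $y\mapsto\delta(y\smile x)$ (likewise for $\widehat X$). The pushforward $\phi_{\mathscr L*}:H^{p,q}(X)\to H^{p,q}(\widehat X)$ is Poincaré duality on $X$, followed by the homology pushforward $\bigwedge^{g-q}(\Phi_E|_\Lambda)\otimes\bigwedge^{g-p}(\Phi_E|_N):H_{g-p,g-q}(X)\to H_{g-p,g-q}(\widehat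 X)$, followed by inverse Poincaré duality on $\widehat X$. Fourier--Mukai: by Künneth $H^{\bullet,\bullet}(X\times\widehat X)=H^{\bullet,\bullet}(X)\otimes H^{\bullet,\bullet}(\widehat X)$, with product $(x\otimes y)\cdot(x'\otimes y')=(-1)^{|x||y'|}(x\smile x')\otimes(y\smile y')$, $|\cdot|$ being the total degree $p+q$. For the projections $p_1,p_2$ of $X\times\widehat X$ to $X,\widehat X$: $p_1^*(x)=x\otimes1$, $p_{2*}(x\otimes y)=\delta(x)y$. The tropical Poincaré bundle $\mathcal P_X$ has $E_X:=c_1(\mathcal P_X)=-\sum_i\eta_i^*\otimes\eta_i-\sum_i\lambda_i^*\otimes\lambda_i$ with $\eta_i^*\in H^{1,0}(X)$, $\eta_i\in H^{0,1}(\widehat X)$, $\lambda_i^*\in H^{0,1}(X)$, $\lambda_i\in H^{1,0}(\widehat X)$. Then $F_{E_X}(\alpha)=p_{2*}\big(e^{c_1(\mathcal P_X)}\cdot p_1^*\alpha\big)$, where $e^{c_1(\mathcal P_X)}=\sum_{k\ge0}\frac1{k!}c_1(\mathcal P_X)^k$. *)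

theory Defs
  imports Complex_Main "HOL-Library.Function_Algebras" "Jordan_Normal_Form.Determinant"
begin

section \<open>Real tori with integral structure\<close>

definition lattice_basis :: "nat \<Rightarrow> (nat \<Rightarrow> 'v::real_vector) \<Rightarrow> 'v set \<Rightarrow> bool" where
  "lattice_basis g b M \<longleftrightarrow>
     inj_on b {..<g} \<and> independent (b ` {..<g}) \<and> span (b ` {..<g}) = UNIV \<and>
     M = {(\<Sum>i<g. real_of_int (c i) *\<^sub>R b i) | c :: nat \<Rightarrow> int. True}"

definition dual_lattice :: "'v::real_vector set \<Rightarrow> ('v \<Rightarrow> real) set" where
  "dual_lattice M = {f. linear f \<and> (\<forall>x\<in>M. f x \<in> \<int>)}"

definition dual_basis :: "nat \<Rightarrow> (nat \<Rightarrow> 'v::real_vector) \<Rightarrow> nat \<Rightarrow> 'v \<Rightarrow> real" where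
  "dual_basis g b i = (\<lambda>x. representation (b ` {..<g}) x (b i))"

text \<open>A torus \<open>N\<^sub>\<real> / \<Lambda>\<close> together with the fixed bases. The real vector space \<open>N\<^sub>\<real> = \<Lambda>\<^sub>\<real>\<close> is the
  whole type \<open>'a\<close>; \<open>periods\<close> is \<open>\<Lambda>\<close> with basis \<open>pbasis\<close> (the \<open>\<lambda>\<^sub>i\<close>), \<open>integral\<close> is \<open>N\<close> with
  basis \<open>ibasis\<close> (the \<open>\<eta>\<^sub>i\<close>); bases are indexed by \<open>{..<tdim}\<close>.\<close>

record 'a torus =
  tdim :: nat
  periods :: "'a set"
  integral :: "'a set"
  pbasis :: "nat \<Rightarrow> 'a"
  ibasis :: "nat \<Rightarrow> 'a"

definition real_torus :: "'v::real_vector torus \<Rightarrow> bool" where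
  "real_torus X \<longleftrightarrow>
     lattice_basis (tdim X) (pbasis X) (periods X) \<and>
     lattice_basis (tdim X) (ibasis X) (integral X) \<and>
     det (mat (tdim X) (tdim X) (\<lambda>(i, j). dual_basis (tdim X) (ibasis X) j (pbasis X i))) > 0"

text \<open>\<open>\<Lambda>\<^sup>*\<^sub>\<real> / N\<^sup>*\<close>: the periods are \<open>N\<^sup>*\<close> and the integral structure is \<open>\<Lambda>\<^sup>*\<close>, both inside the
  real dual space.\<close>

definition dual_torus :: "'v::real_vector torus \<Rightarrow> ('v \<Rightarrow> real) torus" where
  "dual_torus X =
     \<lparr>tdim = tdim X,
      periods = dual_lattice (integral X),
      integral = dual_lattice (periods X),
      pbasis = dual_basis (tdim X) (ibasis X),
      ibasis = dual_basis (tdim X) (pbasis X)\<rparr>"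


section \<open>Tropical line bundles\<close>

text \<open>The pair \<open>(E, l)\<close> of \<open>\<L>(E, l)\<close>; an element of \<open>Hom(\<Lambda>, \<real>)\<close> is given by its linear
  extension to \<open>\<Lambda>\<^sub>\<real>\<close>.\<close>

record 'v line_bundle =
  chern :: "'v \<Rightarrow> 'v \<Rightarrow> real"
  lpart :: "'v \<Rightarrow> real"

definition tropical_line_bundle :: "'v::real_vector torus \<Rightarrow> 'v line_bundle \<Rightarrow> bool" where
  "tropical_line_bundle X L \<longleftrightarrow>
     (\<forall>x. linear (chern L x)) \<and> (\<forall>y. linear (\<lambda>x. chern L x y)) \<and>
     (\<forall>x y. chern L x y = chern L y x) \<and>
     (\<forall>x\<in>periods X. \<forall>y\<in>integral X. chern L x y \<in> \<int>) \<and>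
     linear (lpart L)"

definition nondegenerate :: "'v::real_vector line_bundle \<Rightarrow> bool" where
  "nondegenerate L \<longleftrightarrow> (\<forall>x. (\<forall>y. chern L x y = 0) \<longrightarrow> x = 0)"

text \<open>\<open>\<L>(E, l)\<close> is the quotient of \<open>N\<^sub>\<real> \<times> \<real>\<close> by \<open>\<lambda> \<cdot> (x, t) = (x + \<lambda>, t + a\<^sub>\<lambda>(x))\<close> for the following
  factor of automorphy \<open>a\<close>. The signs are those for which \<open>t\<^sub>x\<^sup>*\<L> \<otimes> \<L>\<^sup>-\<^sup>1\<close> is
  \<open>\<L>(0, -E(-, x))\<close>.\<close>

definition automorphy :: "'v::real_vector line_bundle \<Rightarrow> 'v \<Rightarrow> 'v \<Rightarrow> real" where
  "automorphy L l x = lpart L l - chern L l x - chern L l l / 2"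

definition lb_tensor :: "'v line_bundle \<Rightarrow> 'v line_bundle \<Rightarrow> 'v line_bundle" where
  "lb_tensor L L' =
     \<lparr>chern = (\<lambda>x y. chern L x y + chern L' x y), lpart = (\<lambda>x. lpart L x + lpart L' x)\<rparr>"

definition lb_inverse :: "'v line_bundle \<Rightarrow> 'v line_bundle" where
  "lb_inverse L = \<lparr>chern = (\<lambda>x y. - chern L x y), lpart = (\<lambda>x. - lpart L x)\<rparr>"

definition lb_translate :: "'v \<Rightarrow> 'v line_bundle \<Rightarrow> 'v line_bundle" where
  "lb_translate x L = \<lparr>chern = chern L, lpart = (\<lambda>y. lpart L y - chern L y x)\<rparr>"

lemma automorphy_cocycle:
  assumes "tropical_line_bundle X L"
  shows "automorphy L (l + m) x = automorphy L l (x + m) + automorphy L m x"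
proof -
  have "chern L (a + b) c = chern L a c + chern L b c" for a b c
    using assms linear_add[of "\<lambda>x. chern L x c"] unfolding tropical_line_bundle_def by blast
  moreover have "chern L c (a + b) = chern L c a + chern L c b" for a b c
    using assms linear_add[of "chern L c"] unfolding tropical_line_bundle_def by blast
  moreover have "lpart L (a + b) = lpart L a + lpart L b" for a b
    using assms linear_add[of "lpart L"] unfolding tropical_line_bundle_def by blast
  moreover have "chern L m l = chern L l m"
    using assms unfolding tropical_line_bundle_def by blast
  ultimately show ?thesis
    by (simp add: automorphy_def field_simps)
qed

lemma automorphy_translate:
  assumes "tropical_line_bundle X L"
  shows "automorphy (lb_translate x L) l y = automorphy L l (y + x)"
proof -
  have "chern L l (y + x) = chern L l y + chern L l x"
    using assms linear_add[of "chern L l"] unfolding tropical_line_bundle_def by blast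
  then show ?thesis by (simp add: automorphy_def lb_translate_def)
qed

lemma automorphy_tensor:
  "automorphy (lb_tensor L L') l x = automorphy L l x + automorphy L' l x"
  by (simp add: automorphy_def lb_tensor_def field_simps)

lemma automorphy_inverse: "automorphy (lb_inverse L) l x = - automorphy L l x"
  by (simp add: automorphy_def lb_inverse_def)

text \<open>The linear lift \<open>N\<^sub>\<real> \<rightarrow> \<Lambda>\<^sup>*\<^sub>\<real>\<close> of \<open>\<phi>\<^bsub>\<L>\<^esub>\<close>, using \<open>\<L>(0, l) \<leftrightarrow> l\<close> on \<open>Pic\<^sup>0\<close>.\<close>

definition phi_lift :: "'v line_bundle \<Rightarrow> 'v \<Rightarrow> 'v \<Rightarrow> real" where
  "phi_lift L x = lpart (lb_tensor (lb_translate x L) (lb_inverse L))"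

lemma phi_lift_eq: "phi_lift L x = (\<lambda>y. - chern L y x)"
  by (simp add: phi_lift_def lb_tensor_def lb_translate_def lb_inverse_def)

lemma chern_translate_inverse: "chern (lb_tensor (lb_translate x L) (lb_inverse L)) = (\<lambda>_ _. 0)"
  by (simp add: lb_tensor_def lb_translate_def lb_inverse_def)

definition det_chern :: "'v::real_vector torus \<Rightarrow> 'v line_bundle \<Rightarrow> real" where
  "det_chern X L =
     det (mat (tdim X) (tdim X) (\<lambda>(i, j). chern L (pbasis X i) (ibasis X j)))"


section \<open>Tropical cohomology\<close>

text \<open>For a lattice \<open>M\<close>, \<open>\<And>\<^sup>k M\<^sup>* \<otimes> \<rat>\<close> is the space of alternating multi-additive \<open>\<rat>\<close>-valued functions
  on \<open>M\<^sup>k\<close>, where \<open>\<alpha>\<^sub>1 \<and> \<dots> \<and> \<alpha>\<^sub>k\<close> is \<open>(v\<^sub>1, \<dots>, v\<^sub>k) \<mapsto> det (\<alpha>\<^sub>i(v\<^sub>j))\<close>. Accordingly a class in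
  \<open>H\<^sup>p\<^sup>,\<^sup>q(X) = \<And>\<^sup>q \<Lambda>\<^sup>* \<otimes> \<And>\<^sup>p N\<^sup>*\<close> is a function of a list of \<open>q\<close> elements of \<open>\<Lambda>\<close> and a list of \<open>p\<close>
  elements of \<open>N\<close>, and a class of mixed bidegree is a function of lists of all lengths. Functions
  vanish off the lattices, so that equality of classes is equality of functions. For the
  dual torus this gives forms on \<open>N\<^sup>*\<close> and \<open>\<Lambda>\<^sup>*\<close>, that is \<open>\<And>\<^sup>q N \<otimes> \<And>\<^sup>p \<Lambda>\<close> with \<open>N\<^sup>*\<^sup>* = N\<close> and
  \<open>\<Lambda>\<^sup>*\<^sup>* = \<Lambda>\<close> by evaluation.\<close>

type_synonym 'a form = "'a list \<Rightarrow> 'a list \<Rightarrow> real"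

definition alternating_on :: "'a::ab_group_add set \<Rightarrow> ('a list \<Rightarrow> real) \<Rightarrow> bool" where
  "alternating_on M \<alpha> \<longleftrightarrow>
     (\<forall>u\<in>lists M. \<forall>i<length u. \<forall>x\<in>M. \<forall>y\<in>M.
        \<alpha> (u[i := x + y]) = \<alpha> (u[i := x]) + \<alpha> (u[i := y])) \<and>
     (\<forall>u\<in>lists M. (\<exists>i j. i < j \<and> j < length u \<and> u ! i = u ! j) \<longrightarrow> \<alpha> u = 0)"

definition cohomology :: "'a::ab_group_add torus \<Rightarrow> nat \<Rightarrow> nat \<Rightarrow> 'a form set" where
  "cohomology X p q = {\<omega>.
     (\<forall>u v. \<omega> u v \<in> \<rat>) \<and>
     (\<forall>u v. \<omega> u v \<noteq> 0 \<longrightarrow>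
        u \<in> lists (periods X) \<and> length u = q \<and> v \<in> lists (integral X) \<and> length v = p) \<and>
     (\<forall>v. alternating_on (periods X) (\<lambda>u. \<omega> u v)) \<and>
     (\<forall>u. alternating_on (integral X) (\<lambda>v. \<omega> u v))}"

text \<open>The sign of the shuffle that moves the positions in \<open>S\<close> to the front.\<close>

definition shuffle_sign :: "nat \<Rightarrow> nat set \<Rightarrow> real" where
  "shuffle_sign n S = (-1) ^ card {(i, j). i \<in> S \<and> j \<in> {..<n} - S \<and> j < i}"

definition wedge :: "('a list \<Rightarrow> real) \<Rightarrow> ('a list \<Rightarrow> real) \<Rightarrow> 'a list \<Rightarrow> real" where
  "wedge \<alpha> \<beta> u = (\<Sum>S\<in>Pow {..<length u}. shuffle_sign (length u) S * \<alpha> (nths u S) * \<beta> (nths u (- S)))"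

definition unit_form :: "'a list \<Rightarrow> real" where
  "unit_form u = (if u = [] then 1 else 0)"

definition one_form :: "'a set \<Rightarrow> ('a \<Rightarrow> real) \<Rightarrow> 'a list \<Rightarrow> real" where
  "one_form M f u = (if length u = 1 \<and> set u \<subseteq> M then f (hd u) else 0)"

definition tensor :: "('a list \<Rightarrow> real) \<Rightarrow> ('b list \<Rightarrow> real) \<Rightarrow> 'a list \<Rightarrow> 'b list \<Rightarrow> real" where
  "tensor \<alpha> \<omega> u v = \<alpha> u * \<omega> v"

definition cup :: "'a form \<Rightarrow> 'a form \<Rightarrow> 'a form" where
  "cup \<omega> \<xi> u v =
     (\<Sum>S\<in>Pow {..<length u}. \<Sum>T\<in>Pow {..<length v}.
        shuffle_sign (length u) S * shuffle_sign (length v) T *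
        \<omega> (nths u S) (nths v T) * \<xi> (nths u (- S)) (nths v (- T)))"

lemma cup_tensor:
  "cup (tensor \<alpha> \<omega>) (tensor \<beta> \<xi>) = tensor (wedge \<alpha> \<beta>) (wedge \<omega> \<xi>)"
  by (intro ext) (simp add: cup_def tensor_def wedge_def sum_product mult_ac)

definition cup_power :: "'a form \<Rightarrow> nat \<Rightarrow> 'a form" where
  "cup_power \<omega> k = (cup \<omega> ^^ k) (tensor unit_form unit_form)"

definition scale :: "real \<Rightarrow> 'a form \<Rightarrow> 'a form" where
  "scale c \<omega> u v = c * \<omega> u v"

definition c1 :: "'v::real_vector torus \<Rightarrow> 'v line_bundle \<Rightarrow> 'v form" where
  "c1 X L u v =
     (if length u = 1 \<and> set u \<subseteq> periods X \<and> length v = 1 \<and> set v \<subseteq> integral X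
      then chern L (hd u) (hd v) else 0)"

text \<open>Evaluation on the bases is the coefficient of the generator
  \<open>(\<lambda>\<^sub>1\<^sup>* \<and> \<dots> \<and> \<lambda>\<^sub>g\<^sup>*) \<otimes> (\<eta>\<^sub>1\<^sup>* \<and> \<dots> \<and> \<eta>\<^sub>g\<^sup>*)\<close>, whose value there is 1.\<close>

definition delta :: "'a torus \<Rightarrow> 'a form \<Rightarrow> real" where
  "delta X \<omega> = \<omega> (map (pbasis X) [0..<tdim X]) (map (ibasis X) [0..<tdim X])"


section \<open>Pushforward along a homomorphism\<close>

text \<open>\<open>H\<^sub>p\<^sub>,\<^sub>q(X)\<close> is represented as the dual space of \<open>H\<^sup>p\<^sup>,\<^sup>q(X)\<close>.\<close>

definition homology_class :: "'a list \<Rightarrow> 'a list \<Rightarrow> 'a form \<Rightarrow> real" where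
  "homology_class u v = (\<lambda>\<omega>. \<omega> u v)"

definition pullback :: "'a torus \<Rightarrow> ('a \<Rightarrow> 'b) \<Rightarrow> 'b form \<Rightarrow> 'a form" where
  "pullback X f \<omega> u v =
     (if u \<in> lists (periods X) \<and> v \<in> lists (integral X) then \<omega> (map f u) (map f v) else 0)"

definition homology_push :: "'a torus \<Rightarrow> ('a \<Rightarrow> 'b) \<Rightarrow> ('a form \<Rightarrow> real) \<Rightarrow> 'b form \<Rightarrow> real" where
  "homology_push X f z = (\<lambda>\<omega>. z (pullback X f \<omega>))"

text \<open>As \<open>homology_class u v\<close> is \<open>(u\<^sub>1 \<and> \<dots> \<and> u\<^sub>q) \<otimes> (v\<^sub>1 \<and> \<dots> \<and> v\<^sub>p)\<close>, the map \<open>homology_push\<close> is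
  \<open>\<And>\<^sup>q(f|\<Lambda>) \<otimes> \<And>\<^sup>p(f|N)\<close>.\<close>

lemma homology_push_class:
  assumes "u \<in> lists (periods X)" and "v \<in> lists (integral X)"
  shows "homology_push X f (homology_class u v) = homology_class (map f u) (map f v)"
  using assms by (simp add: homology_push_def homology_class_def pullback_def)

definition poincare :: "'a torus \<Rightarrow> 'a form \<Rightarrow> 'a form \<Rightarrow> real" where
  "poincare X x = (\<lambda>y. delta X (cup y x))"

definition poincare_inv ::
    "'a::ab_group_add torus \<Rightarrow> nat \<Rightarrow> nat \<Rightarrow> ('a form \<Rightarrow> real) \<Rightarrow> 'a form" where
  "poincare_inv X p q z =
     (THE x. x \<in> cohomology X p q \<and>
             (\<forall>y\<in>cohomology X (tdim X - p) (tdim X - q). poincare X x y = z y))"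

definition phi_push ::
    "'v::real_vector torus \<Rightarrow> 'v line_bundle \<Rightarrow> nat \<Rightarrow> nat \<Rightarrow> 'v form \<Rightarrow> ('v \<Rightarrow> real) form" where
  "phi_push X L p q x =
     poincare_inv (dual_torus X) p q (homology_push X (phi_lift L) (poincare X x))"


section \<open>Fourier--Mukai transform\<close>

text \<open>Classes on a product, with the Kuenneth decomposition \<open>H(X) \<otimes> H(Y)\<close> built in.\<close>

type_synonym ('a, 'b) kform = "'a list \<Rightarrow> 'a list \<Rightarrow> 'b list \<Rightarrow> 'b list \<Rightarrow> real"

definition ktensor :: "'a form \<Rightarrow> 'b form \<Rightarrow> ('a, 'b) kform" where
  "ktensor x y u v s t = x u v * y s t"

text \<open>The last sign is \<open>(-1)\<^bsup>|x||y'|\<^esup>\<close>.\<close>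

definition kprod :: "('a, 'b) kform \<Rightarrow> ('a, 'b) kform \<Rightarrow> ('a, 'b) kform" where
  "kprod A B u v s t =
     (\<Sum>S\<in>Pow {..<length u}. \<Sum>T\<in>Pow {..<length v}. \<Sum>U\<in>Pow {..<length s}. \<Sum>W\<in>Pow {..<length t}.
        shuffle_sign (length u) S * shuffle_sign (length v) T *
        shuffle_sign (length s) U * shuffle_sign (length t) W *
        (-1) ^ ((length (nths u S) + length (nths v T)) *
                (length (nths s (- U)) + length (nths t (- W)))) *
        A (nths u S) (nths v T) (nths s U) (nths t W) *
        B (nths u (- S)) (nths v (- T)) (nths s (- U)) (nths t (- W)))"

definition kunit :: "('a, 'b) kform" where
  "kunit = ktensor (tensor unit_form unit_form) (tensor unit_form unit_form)"

definition kpower :: "('a, 'b) kform \<Rightarrow> nat \<Rightarrow> ('a, 'b) kform" where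
  "kpower A k = (kprod A ^^ k) kunit"

definition kexp :: "('a, 'b) kform \<Rightarrow> ('a, 'b) kform" where
  "kexp A u v s t = (\<Sum>k. kpower A k u v s t / fact k)"

definition c1_poincare :: "'v::real_vector torus \<Rightarrow> ('v, 'v \<Rightarrow> real) kform" where
  "c1_poincare X =
     - (\<Sum>i<tdim X.
          ktensor (tensor unit_form (one_form (integral X) (dual_basis (tdim X) (ibasis X) i)))
                  (tensor (one_form (dual_lattice (integral X)) (\<lambda>f. f (ibasis X i))) unit_form))
     - (\<Sum>i<tdim X.
          ktensor (tensor (one_form (periods X) (dual_basis (tdim X) (pbasis X) i)) unit_form)
                  (tensor unit_form (one_form (dual_lattice (periods X)) (\<lambda>f. f (pbasis X i)))))"

definition proj1_pull :: "'a form \<Rightarrow> ('a, 'b) kform" where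
  "proj1_pull x = ktensor x (tensor unit_form unit_form)"

definition proj2_push :: "'a torus \<Rightarrow> ('a, 'b) kform \<Rightarrow> 'b form" where
  "proj2_push X A s t = delta X (\<lambda>u v. A u v s t)"

definition fourier_mukai :: "'v::real_vector torus \<Rightarrow> 'v form \<Rightarrow> ('v \<Rightarrow> real) form" where
  "fourier_mukai X \<alpha> = proj2_push X (kprod (kexp (c1_poincare X)) (proj1_pull \<alpha>))"

lemma proj2_push_ktensor: "proj2_push X (ktensor x y) = scale (delta X x) y"
  by (intro ext) (simp add: proj2_push_def ktensor_def delta_def scale_def)

lemma kprod_ktensor:
  assumes "\<And>u v. x u v \<noteq> 0 \<Longrightarrow> length u + length v = d"
    and "\<And>s t. y' s t \<noteq> 0 \<Longrightarrow> length s + length t = e"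
  shows "kprod (ktensor x y) (ktensor x' y') =
         (\<lambda>u v s t. (-1) ^ (d * e) * ktensor (cup x x') (cup y y') u v s t)"
proof (intro ext)
  fix u v s t
  have "(-1) ^ ((length a + length b) * (length c + length c')) *
        (x a b * y m n) * (x' a' b' * y' c c') =
        (-1) ^ (d * e) * (x a b * y m n) * (x' a' b' * y' c c')" for a b c c' a' b' m n
    using assms(1)[of a b] assms(2)[of c c']
    by (cases "x a b = 0"; cases "y' c c' = 0") auto
  then have sgn: "r * (-1) ^ ((length a + length b) * (length c + length c')) *
        (x a b * y m n) * (x' a' b' * y' c c') =
        r * ((-1) ^ (d * e) * (x a b * y m n) * (x' a' b' * y' c c'))" for r a b c c' a' b' m n
    by (metis mult.assoc)
  show "kprod (ktensor x y) (ktensor x' y') u v s t =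
        (-1) ^ (d * e) * ktensor (cup x x') (cup y y') u v s t"
    unfolding kprod_def ktensor_def sgn cup_def sum_distrib_right
    unfolding sum_distrib_left
    by (intro sum.cong refl) (simp add: mult_ac)
qed

end

theory Submission
  imports Defs
begin

text \<open>Write \<open>k = g - p\<close>. In the basis-free description of forms, \<open>c\<^sub>1(\<L>)\<^sup>n / n!\<close> is the form
  \<open>(u, v) \<mapsto> det E(u\<^sub>i, v\<^sub>j)\<close> and \<open>exp c\<^sub>1(\<P>)\<close> is up to sign a product of two pairing determinants.
  Hence the transform \<open>F\<close> of \<open>c\<^sub>1(\<L>)\<^sup>p / p!\<close> is a double shuffle sum of products of three minors.
  On arguments \<open>\<Phi>(u)\<close>, \<open>\<Phi>(v)\<close> Laplace expansion collapses it to \<open>(-1)\<^sup>k det E \<cdot> det E(u\<^sub>i, v\<^sub>j)\<close>, so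
  that the pullback of \<open>(-1)\<^sup>k det E \<cdot> F\<close> along \<open>\<phi>\<close> is \<open>(det E)\<^sup>2 c\<^sub>1(\<L>)\<^sup>k / k!\<close>. As \<open>\<phi>\<close> multiplies top
  classes by \<open>(det E)\<^sup>2\<close>, the class \<open>(-1)\<^sup>k det E \<cdot> F\<close> satisfies the defining property of the pushforward
  of \<open>c\<^sub>1(\<L>)\<^sup>k / k!\<close>.\<close>

section \<open>Shuffle sums\<close>

text \<open>Products of forms are given as sums over sets of positions with inversion signs. They
  are rewritten as a recursion on the first letter, which joins either block; in the second block it
  is crossed by every letter of the first, whence the sign \<open>(-1) ^ length a\<close>.
  Commutativity, associativity and Laplace expansion become inductions on lists in which no
  permutation occurs. The sign (-1)^k of the theorem belongs to the degree 2k part of exp c1(P),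
  where it appears as (-1)^(k(2k+1)). The two signs (-1)^k caused by the minus sign in \<Phi> cancel
  each other. The obstacle is that \<Phi> maps the two lattices into the dual lattices but in
  general not onto them, so the dual bases, on which \<open>delta\<close> is evaluated, need not be
  images. Therefore classes are compared after multiplication with a test class: the product is a
  top form, and proportionality of top forms carries values from the images of the bases to the dual
  bases. As the pushforward is a definite description, uniqueness is needed too; contractions of a
  volume form serve as test classes for it.\<close>

fun shuffle_sum :: "('a list \<Rightarrow> 'a list \<Rightarrow> real) \<Rightarrow> 'a list \<Rightarrow> real" where
  "shuffle_sum m [] = m [] []"
| "shuffle_sum m (x # u) =
     shuffle_sum (\<lambda>a b. m (x # a) b) u + shuffle_sum (\<lambda>a b. (-1) ^ length a * m a (x # b)) u"

lemma shuffle_sum_cong: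
  assumes "\<And>a b. set a \<union> set b = set u \<Longrightarrow> length a + length b = length u \<Longrightarrow> m a b = m' a b"
  shows "shuffle_sum m u = shuffle_sum m' u"
  using assms
proof (induction u arbitrary: m m')
  case (Cons x u)
  have "shuffle_sum (\<lambda>a b. m (x # a) b) u = shuffle_sum (\<lambda>a b. m' (x # a) b) u"
    by (rule Cons.IH, rule Cons.prems) auto
  moreover have "shuffle_sum (\<lambda>a b. (-1) ^ length a * m a (x # b)) u =
      shuffle_sum (\<lambda>a b. (-1) ^ length a * m' a (x # b)) u"
    by (rule Cons.IH, rule arg_cong[where f = "(*) _"], rule Cons.prems) auto
  ultimately show ?case by simp
qed simp

lemma shuffle_sum_add:
  "shuffle_sum (\<lambda>a b. m a b + m' a b) u = shuffle_sum m u + shuffle_sum m' u"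
  by (induction u arbitrary: m m') (simp_all add: distrib_left)

lemma shuffle_sum_cmult: "shuffle_sum (\<lambda>a b. c * m a b) u = c * shuffle_sum m u"
proof (induction u arbitrary: m)
  case (Cons x u)
  then show ?case
    using Cons[of "\<lambda>a b. (-1) ^ length a * m a (x # b)"] by (simp add: mult.left_commute distrib_left)
qed simp

lemma shuffle_sum_cmult_right: "shuffle_sum (\<lambda>a b. m a b * c) u = shuffle_sum m u * c"
  using shuffle_sum_cmult[of c m u] by (simp add: mult.commute)

lemma shuffle_sum_0: "shuffle_sum (\<lambda>a b. 0) u = 0"
  by (induction u) simp_all

lemma shuffle_sum_eq_0:
  assumes "\<And>a b. set a \<union> set b = set u \<Longrightarrow> length a + length b = length u \<Longrightarrow> m a b = 0"
  shows "shuffle_sum m u = 0"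
  using shuffle_sum_cong[of u m "\<lambda>a b. 0"] assms by (simp add: shuffle_sum_0)

text \<open>Graded commutativity: exchanging the two blocks moves every letter of one past every
  letter of the other.\<close>

lemma shuffle_sum_swap:
  "shuffle_sum (\<lambda>a b. m b a) u = shuffle_sum (\<lambda>a b. (-1) ^ (length a * length b) * m a b) u"
proof (induction u arbitrary: m)
  case (Cons x u)
  show ?case
    using Cons.IH[of "\<lambda>a b. m a (x # b)"] Cons.IH[of "\<lambda>a b. (-1) ^ length b * m (x # a) b"]
    by (simp add: power_add mult_ac)
qed simp

lemma shuffle_sum_commute:
  "shuffle_sum (\<lambda>a b. shuffle_sum (\<lambda>c d. m a b c d) v) u =
   shuffle_sum (\<lambda>c d. shuffle_sum (\<lambda>a b. m a b c d) u) v"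
  by (induction u arbitrary: m)
    (simp_all add: shuffle_sum_add flip: shuffle_sum_cmult)

text \<open>Both sides run over the splittings of \<open>u\<close> into three blocks, and the sign
  counts the inversions between each pair of blocks, so the order of the two cuts is immaterial.
  Laplace expansion along several rows rests on this.\<close>

lemma shuffle_sum_assoc:
  "shuffle_sum (\<lambda>a b. shuffle_sum (\<lambda>c d. m c d b) a) u =
   shuffle_sum (\<lambda>a b. shuffle_sum (\<lambda>c d. m a c d) b) u"
proof (induction u arbitrary: m)
  case (Cons x u)
  \<comment> \<open>A letter that enters the last block crosses all of \<open>a\<close>, that is,
    all of \<open>c\<close> and all of \<open>d\<close>; its sign splits accordingly.\<close>
  have "shuffle_sum (\<lambda>a b. (-1) ^ length a * shuffle_sum (\<lambda>c d. m c d (x # b)) a) u =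
      shuffle_sum (\<lambda>a b. shuffle_sum (\<lambda>c d. (-1) ^ length c * (-1) ^ length d * m c d (x # b)) a) u"
    by (rule shuffle_sum_cong, unfold shuffle_sum_cmult[symmetric], rule shuffle_sum_cong)
      (simp flip: power_add)
  also have "\<dots> = shuffle_sum (\<lambda>a b. shuffle_sum (\<lambda>c d. (-1) ^ length a * (-1) ^ length c * m a c (x # d)) b) u"
    by (rule Cons.IH)
  finally show ?case
    using Cons.IH[of "\<lambda>c d b. m (x # c) d b"] Cons.IH[of "\<lambda>c d b. (-1) ^ length c * m c (x # d) b"]
    by (simp add: shuffle_sum_add distrib_left mult.assoc flip: shuffle_sum_cmult)
qed simp

lemma shuffle_sum_map:
  "shuffle_sum m (map f u) = shuffle_sum (\<lambda>a b. m (map f a) (map f b)) u"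
  by (induction u arbitrary: m) simp_all

lemma shuffle_sum_Nil_left: "shuffle_sum (\<lambda>a b. if a = [] then h b else 0) u = h u"
proof (induction u arbitrary: h)
  case (Cons x u)
  have "shuffle_sum (\<lambda>a b. (-1) ^ length a * (if a = [] then h (x # b) else 0)) u =
      shuffle_sum (\<lambda>a b. if a = [] then h (x # b) else 0) u"
    by (rule shuffle_sum_cong) simp
  with Cons.IH[of "\<lambda>b. h (x # b)"] show ?case by (simp add: shuffle_sum_0)
qed simp

lemma shuffle_sum_Nil_right: "shuffle_sum (\<lambda>a b. if b = [] then h a else 0) u = h u"
  by (induction u arbitrary: h) (simp_all add: shuffle_sum_0)

lemma shuffle_sum_Ints:
  assumes "\<And>a b. set a \<subseteq> set u \<Longrightarrow> set b \<subseteq> set u \<Longrightarrow> m a b \<in> \<int>"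
  shows "shuffle_sum m u \<in> \<int>"
  using assms
proof (induction u arbitrary: m)
  case (Cons x u)
  have "shuffle_sum (\<lambda>a b. m (x # a) b) u \<in> \<int>"
    by (rule Cons.IH, rule Cons.prems) auto
  moreover have "shuffle_sum (\<lambda>a b. (-1) ^ length a * m a (x # b)) u \<in> \<int>"
    by (rule Cons.IH, intro Ints_mult Ints_power Cons.prems) auto
  ultimately show ?case by simp
qed simp

section \<open>Comparison of the recursion with sums over sets of positions\<close>

lemma shuffle_sign_Suc:
  assumes "S \<subseteq> {..<n}"
  shows "shuffle_sign (Suc n) (insert 0 (Suc ` S)) = shuffle_sign n S"
    and "shuffle_sign (Suc n) (Suc ` S) = (-1) ^ card S * shuffle_sign n S"
proof -
  let ?I = "{(i, j). i \<in> S \<and> j \<in> {..<n} - S \<and> j < i}"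
  have fin: "finite S" using assms finite_subset by blast
  have fI: "finite ?I"
    by (rule finite_subset[of _ "S \<times> {..<n}"]) (use fin in auto)
  have inj: "inj_on (map_prod Suc Suc) A" for A
    by (auto simp: inj_on_def)
  have "{(i, j). i \<in> insert 0 (Suc ` S) \<and> j \<in> {..<Suc n} - insert 0 (Suc ` S) \<and> j < i} =
      map_prod Suc Suc ` ?I"
    by (auto simp: image_iff gr0_conv_Suc)
  then show "shuffle_sign (Suc n) (insert 0 (Suc ` S)) = shuffle_sign n S"
    by (simp add: shuffle_sign_def card_image[OF inj])
  \<comment> \<open>With position 0 outside the set, every element of \<open>S\<close> acquires one
    new inversion \<open>(Suc i, 0)\<close>; the old inversions are shifted.\<close>
  have eq: "{(i, j). i \<in> Suc ` S \<and> j \<in> {..<Suc n} - Suc ` S \<and> j < i} =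
      map_prod Suc Suc ` ?I \<union> (\<lambda>i. (Suc i, 0)) ` S" (is "?L = ?R")
  proof (intro Set.set_eqI iffI)
    fix z assume "z \<in> ?L"
    then obtain i j where z: "z = (Suc i, j)" "i \<in> S" "j < Suc n" "j \<notin> Suc ` S" "j < Suc i"
      by auto
    show "z \<in> ?R"
    proof (cases j)
      case (Suc k)
      with z have "(i, k) \<in> ?I" by auto
      then have "map_prod Suc Suc (i, k) \<in> map_prod Suc Suc ` ?I" by (rule imageI)
      with Suc z(1) show ?thesis by simp
    qed (use z in auto)
  qed (use assms in auto)
  have "card ?R = card ?I + card S"
    by (subst card_Un_disjoint)
      (use fI fin in \<open>auto simp: card_image[OF inj] card_image inj_on_def\<close>)
  then show "shuffle_sign (Suc n) (Suc ` S) = (-1) ^ card S * shuffle_sign n S"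
    unfolding shuffle_sign_def eq by (simp add: power_add)
qed

lemma length_nths_subset: "S \<subseteq> {..<length u} \<Longrightarrow> length (nths u S) = card S"
  unfolding length_nths by (rule arg_cong[where f = card]) auto

lemma Pow_lessThan_Suc:
  "Pow {..<Suc n} = (\<lambda>S. insert 0 (Suc ` S)) ` Pow {..<n} \<union> (image Suc) ` Pow {..<n}"
proof (intro equalityI subsetI)
  fix S assume S: "S \<in> Pow {..<Suc n}"
  define T where "T = {i. Suc i \<in> S}"
  have T: "T \<in> Pow {..<n}" using S by (auto simp: T_def)
  have "S = insert 0 (Suc ` T) \<or> S = Suc ` T"
  proof (cases "0 \<in> S")
    case True
    have "S = insert 0 (Suc ` T)"
    proof (intro Set.set_eqI)
      fix i show "i \<in> S \<longleftrightarrow> i \<in> insert 0 (Suc ` T)" using True by (cases i) (auto simp: T_def)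
    qed
    then show ?thesis ..
  next
    case False
    have "S = Suc ` T"
    proof (intro Set.set_eqI)
      fix i show "i \<in> S \<longleftrightarrow> i \<in> Suc ` T" using False by (cases i) (auto simp: T_def)
    qed
    then show ?thesis ..
  qed
  with T show "S \<in> (\<lambda>S. insert 0 (Suc ` S)) ` Pow {..<n} \<union> (image Suc) ` Pow {..<n}" by blast
qed auto

text \<open>The sets of positions that contain 0 give the first summand of the recursion, the others
  the second. All products enter the recursive calculus through this identity.\<close>

lemma sum_shuffles_eq_shuffle_sum:
  "(\<Sum>S\<in>Pow {..<length u}. shuffle_sign (length u) S * m (nths u S) (nths u (- S))) = shuffle_sum m u"
proof (induction u arbitrary: m)
  case Nil
  show ?case by (simp add: shuffle_sign_def)
next
  case (Cons x u)
  let ?n = "length u"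
  let ?f = "\<lambda>S. shuffle_sign (Suc ?n) S * m (nths (x # u) S) (nths (x # u) (- S))"
  have pre: "{j. Suc j \<in> insert 0 (Suc ` S)} = S" "{j. Suc j \<in> - insert 0 (Suc ` S)} = - S"
    "{j. Suc j \<in> Suc ` S} = S" "{j. Suc j \<in> - Suc ` S} = - S" for S
    by auto
  have inj1: "inj_on (\<lambda>S. insert 0 (Suc ` S)) (Pow {..<?n})"
    by (rule inj_onI) (metis pre(1))
  have inj2: "inj_on (image Suc) (Pow {..<?n})"
    by (rule inj_onI) (metis pre(3))
  have "(\<Sum>S\<in>Pow {..<Suc ?n}. ?f S) =
      (\<Sum>S\<in>(\<lambda>S. insert 0 (Suc ` S)) ` Pow {..<?n}. ?f S) + (\<Sum>S\<in>(image Suc) ` Pow {..<?n}. ?f S)"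
    unfolding Pow_lessThan_Suc by (rule sum.union_disjoint) auto
  also have "\<dots> = (\<Sum>S\<in>Pow {..<?n}. ?f (insert 0 (Suc ` S))) + (\<Sum>S\<in>Pow {..<?n}. ?f (Suc ` S))"
    by (simp only: sum.reindex[OF inj1] sum.reindex[OF inj2] o_def)
  also have "(\<Sum>S\<in>Pow {..<?n}. ?f (insert 0 (Suc ` S))) = shuffle_sum (\<lambda>a b. m (x # a) b) u"
    by (subst Cons.IH[symmetric], rule sum.cong)
      (simp_all only: PowD shuffle_sign_Suc nths_Cons pre, simp)
  also have "(\<Sum>S\<in>Pow {..<?n}. ?f (Suc ` S)) =
      shuffle_sum (\<lambda>a b. (-1) ^ length a * m a (x # b)) u"
    by (subst Cons.IH[symmetric], rule sum.cong)
      (simp_all only: PowD shuffle_sign_Suc nths_Cons pre length_nths_subset, auto)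
  finally show ?case by simp
qed

lemma cup_eq_shuffle_sum:
  "cup \<omega> \<xi> u v = shuffle_sum (\<lambda>a b. shuffle_sum (\<lambda>c d. \<omega> a c * \<xi> b d) v) u"
  unfolding cup_def sum_shuffles_eq_shuffle_sum[symmetric] sum_distrib_left
  by (intro sum.cong refl) (simp add: mult_ac)

lemma kprod_eq_shuffle_sum:
  "kprod A B u v s t =
   shuffle_sum (\<lambda>u1 u2. shuffle_sum (\<lambda>v1 v2. shuffle_sum (\<lambda>s1 s2. shuffle_sum (\<lambda>t1 t2.
     (-1) ^ ((length u1 + length v1) * (length s2 + length t2)) *
     A u1 v1 s1 t1 * B u2 v2 s2 t2) t) s) v) u"
  unfolding kprod_def sum_shuffles_eq_shuffle_sum[symmetric] sum_distrib_left
  by (intro sum.cong refl) (simp add: mult_ac)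

section \<open>Alternating multi-additive functions\<close>

text \<open>A form of \<open>alternating_on\<close> suited to list induction: prefix and suffix are
  explicit, and vanishing is required only for equal neighbours, since with additivity this already
  makes neighbours anticommute when \<open>M\<close> is closed under addition.\<close>

definition alt :: "'a::ab_group_add set \<Rightarrow> ('a list \<Rightarrow> real) \<Rightarrow> bool" where
  "alt M \<alpha> \<longleftrightarrow>
     (\<forall>p q x y. set p \<subseteq> M \<longrightarrow> set q \<subseteq> M \<longrightarrow> x \<in> M \<longrightarrow> y \<in> M \<longrightarrow>
        \<alpha> (p @ (x + y) # q) = \<alpha> (p @ x # q) + \<alpha> (p @ y # q)) \<and>
     (\<forall>p q x. set p \<subseteq> M \<longrightarrow> set q \<subseteq> M \<longrightarrow> x \<in> M \<longrightarrow> \<alpha> (p @ x # x # q) = 0)"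

lemma altI:
  assumes "\<And>p q x y. set p \<subseteq> M \<Longrightarrow> set q \<subseteq> M \<Longrightarrow> x \<in> M \<Longrightarrow> y \<in> M \<Longrightarrow>
        \<alpha> (p @ (x + y) # q) = \<alpha> (p @ x # q) + \<alpha> (p @ y # q)"
    and "\<And>p q x. set p \<subseteq> M \<Longrightarrow> set q \<subseteq> M \<Longrightarrow> x \<in> M \<Longrightarrow> \<alpha> (p @ x # x # q) = 0"
  shows "alt M \<alpha>"
  using assms unfolding alt_def by blast

lemma alt_add:
  assumes "alt M \<alpha>" "set p \<subseteq> M" "set q \<subseteq> M" "x \<in> M" "y \<in> M"
  shows "\<alpha> (p @ (x + y) # q) = \<alpha> (p @ x # q) + \<alpha> (p @ y # q)"
  using assms unfolding alt_def by blast

lemma alt_adjacent: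
  assumes "alt M \<alpha>" "set p \<subseteq> M" "set q \<subseteq> M" "x \<in> M"
  shows "\<alpha> (p @ x # x # q) = 0"
  using assms unfolding alt_def by blast

lemma alt_append:
  assumes "alt M \<alpha>" "set r \<subseteq> M"
  shows "alt M (\<lambda>u. \<alpha> (r @ u))"
proof (rule altI)
  fix p q x y assume "set p \<subseteq> M" "set q \<subseteq> M" "x \<in> M" "y \<in> M"
  then show "\<alpha> (r @ p @ (x + y) # q) = \<alpha> (r @ p @ x # q) + \<alpha> (r @ p @ y # q)"
    using alt_add[OF assms(1), of "r @ p" q x y] assms(2) by simp
next
  fix p q x assume "set p \<subseteq> M" "set q \<subseteq> M" "x \<in> M"
  then show "\<alpha> (r @ p @ x # x # q) = 0"
    using alt_adjacent[OF assms(1), of "r @ p" q x] assms(2) by simp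
qed

lemma alt_Cons: "alt M \<alpha> \<Longrightarrow> x \<in> M \<Longrightarrow> alt M (\<lambda>u. \<alpha> (x # u))"
  using alt_append[of M \<alpha> "[x]"] by simp

text \<open>Each defining equation relates lists of one length, so the scalar may depend on the
  length. This admits the shuffle signs.\<close>

lemma alt_length_mult:
  assumes "alt M \<alpha>"
  shows "alt M (\<lambda>u. c (length u) * \<alpha> u)"
  using assms by (intro altI) (simp_all add: alt_add alt_adjacent distrib_left)

lemma alt_cmult: "alt M \<alpha> \<Longrightarrow> alt M (\<lambda>u. c * \<alpha> u)"
  by (rule alt_length_mult)

lemma alt_diff: "alt M \<alpha> \<Longrightarrow> alt M \<beta> \<Longrightarrow> alt M (\<lambda>u. \<alpha> u - \<beta> u)"
  by (intro altI) (simp_all add: alt_add alt_adjacent)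

lemma alt_cong:
  assumes "alt M \<alpha>" "\<And>u. set u \<subseteq> M \<Longrightarrow> \<beta> u = \<alpha> u"
    and "\<And>x y. x \<in> M \<Longrightarrow> y \<in> M \<Longrightarrow> x + y \<in> M"
  shows "alt M \<beta>"
  using assms(1) by (intro altI) (simp_all add: assms(2,3) alt_add alt_adjacent)

lemma alt_swap:
  assumes "alt M \<alpha>" and M: "\<And>x y. x \<in> M \<Longrightarrow> y \<in> M \<Longrightarrow> x + y \<in> M"
    and "set p \<subseteq> M" "set q \<subseteq> M" "x \<in> M" "y \<in> M"
  shows "\<alpha> (p @ x # y # q) = - \<alpha> (p @ y # x # q)"
proof -
  have "0 = \<alpha> (p @ (x + y) # (x + y) # q)"
    using assms by (simp add: alt_adjacent)
  also have "\<dots> = \<alpha> (p @ x # (x + y) # q) + \<alpha> (p @ y # (x + y) # q)"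
    using assms by (intro alt_add) auto
  also have "\<alpha> (p @ x # (x + y) # q) = \<alpha> (p @ x # y # q)"
    using alt_add[OF assms(1), of "p @ [x]" q x y] assms by (simp add: alt_adjacent)
  also have "\<alpha> (p @ y # (x + y) # q) = \<alpha> (p @ y # x # q)"
    using alt_add[OF assms(1), of "p @ [y]" q x y] assms by (simp add: alt_adjacent)
  finally show ?thesis by simp
qed

lemma alt_move_front:
  assumes "alt M \<alpha>" and M: "\<And>x y. x \<in> M \<Longrightarrow> y \<in> M \<Longrightarrow> x + y \<in> M"
    and "set p \<subseteq> M" "set q \<subseteq> M" "x \<in> M"
  shows "\<alpha> (p @ x # q) = (-1) ^ length p * \<alpha> (x # p @ q)"
proof -
  have "\<alpha> (r @ p @ x # q) = (-1) ^ length p * \<alpha> (r @ x # p @ q)" if "set r \<subseteq> M" for r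
    using that assms(3)
  proof (induction p arbitrary: r)
    case (Cons z p)
    have "\<alpha> (r @ z # x # p @ q) = - \<alpha> (r @ x # z # p @ q)"
      using Cons.prems assms by (intro alt_swap[OF assms(1,2)]) auto
    with Cons.IH[of "r @ [z]"] Cons.prems show ?case by simp
  qed simp
  from this[of "[]"] show ?thesis by simp
qed

lemma alt_repeated:
  assumes "alt M \<alpha>" and M: "\<And>x y. x \<in> M \<Longrightarrow> y \<in> M \<Longrightarrow> x + y \<in> M"
    and "set u \<subseteq> M" "\<not> distinct u"
  shows "\<alpha> u = 0"
proof -
  obtain p q r x where u: "u = p @ [x] @ q @ [x] @ r"
    using not_distinct_decomp[OF assms(4)] by blast
  have "alt M (\<lambda>u. \<alpha> ((p @ [x]) @ u))"
    using assms(1) by (rule alt_append) (use assms(3) u in auto)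
  from alt_move_front[OF this M, of q r x]
  have "\<alpha> u = (-1) ^ length q * \<alpha> (p @ x # x # q @ r)"
    using assms(3) by (simp add: u)
  also have "\<alpha> (p @ x # x # q @ r) = 0"
    using assms(1,3) by (intro alt_adjacent) (auto simp: u)
  finally show ?thesis by simp
qed

text \<open>A permutation changes an alternating value by a sign only. As just the vanishing is
  wanted, the sign of the permutation is never formed.\<close>

lemma alt_mset:
  assumes "alt M \<alpha>" and M: "\<And>x y. x \<in> M \<Longrightarrow> y \<in> M \<Longrightarrow> x + y \<in> M"
    and "set u \<subseteq> M" "mset u = mset w" "\<alpha> u = 0"
  shows "\<alpha> w = 0"
  using assms(1,3,4,5)
proof (induction u arbitrary: \<alpha> w)
  case (Cons x u)
  have "x \<in> set w" using Cons.prems(3) by (metis list.set_intros(1) set_mset_mset)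
  then obtain p q where w: "w = p @ x # q" by (meson split_list)
  have sw: "set w \<subseteq> M" using Cons.prems(2,3) by (metis set_mset_mset)
  have "alt M (\<lambda>u. \<alpha> (x # u))" using Cons.prems by (intro alt_Cons) auto
  moreover have "mset u = mset (p @ q)" using Cons.prems(3) w by simp
  ultimately have "\<alpha> (x # p @ q) = 0" using Cons.IH[of "\<lambda>u. \<alpha> (x # u)" "p @ q"] Cons.prems by simp
  then show ?case using alt_move_front[OF Cons.prems(1) M, of p q x] sw w by simp
qed simp

lemma alternating_on_iff_alt:
  assumes M: "\<And>x y. x \<in> M \<Longrightarrow> y \<in> M \<Longrightarrow> x + y \<in> M"
  shows "alternating_on M \<alpha> \<longleftrightarrow> alt M \<alpha>"
proof
  assume A: "alternating_on M \<alpha>"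
  show "alt M \<alpha>"
  proof (rule altI)
    fix p q x y assume *: "set p \<subseteq> M" "set q \<subseteq> M" "x \<in> M" "y \<in> M"
    let ?u = "p @ x # q"
    have "?u \<in> lists M" "length p < length ?u" using * by auto
    then have "\<alpha> (?u[length p := x + y]) = \<alpha> (?u[length p := x]) + \<alpha> (?u[length p := y])"
      using A * unfolding alternating_on_def by blast
    then show "\<alpha> (p @ (x + y) # q) = \<alpha> (p @ x # q) + \<alpha> (p @ y # q)" by simp
  next
    fix p q x assume *: "set p \<subseteq> M" "set q \<subseteq> M" "x \<in> M"
    let ?u = "p @ x # x # q"
    have "?u \<in> lists M" using * by auto
    moreover have "length p < Suc (length p) \<and> Suc (length p) < length ?u \<and>
        ?u ! length p = ?u ! Suc (length p)" by (simp add: nth_append)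
    ultimately show "\<alpha> ?u = 0" using A unfolding alternating_on_def by blast
  qed
next
  assume A: "alt M \<alpha>"
  show "alternating_on M \<alpha>"
    unfolding alternating_on_def
  proof (intro conjI ballI allI impI)
    fix u i x y assume *: "u \<in> lists M" "i < length u" "x \<in> M" "y \<in> M"
    have "set (take i u) \<subseteq> M" "set (drop (Suc i) u) \<subseteq> M"
      using * set_take_subset set_drop_subset by fastforce+
    then show "\<alpha> (u[i := x + y]) = \<alpha> (u[i := x]) + \<alpha> (u[i := y])"
      using alt_add[OF A _ _ *(3,4)] *(2) by (simp add: upd_conv_take_nth_drop)
  next
    fix u assume "u \<in> lists M" "\<exists>i j. i < j \<and> j < length u \<and> u ! i = u ! j"
    then have "set u \<subseteq> M" "\<not> distinct u" by (auto simp: distinct_conv_nth) (metis less_imp_neq order.strict_trans)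
    then show "\<alpha> u = 0" using alt_repeated[OF A M] by blast
  qed
qed

text \<open>The wedge product of alternating functions is alternating. For neighbours
  \<open>x\<close>, \<open>x\<close>, the terms with both in one block vanish, and the two mixed
  terms cancel because the second \<open>x\<close> crosses one letter more in one of them.\<close>

lemma alt_shuffle_sum:
  assumes "\<And>b. set b \<subseteq> M \<Longrightarrow> alt M (\<lambda>a. m a b)" and "\<And>a. set a \<subseteq> M \<Longrightarrow> alt M (m a)"
    and M: "\<And>x y. x \<in> M \<Longrightarrow> y \<in> M \<Longrightarrow> x + y \<in> M"
  shows "alt M (shuffle_sum m)"
proof (rule altI)
  fix p q x y assume *: "set p \<subseteq> M" "set q \<subseteq> M" "x \<in> M" "y \<in> M"
  from assms(1,2) *(1) show "shuffle_sum m (p @ (x + y) # q) =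
      shuffle_sum m (p @ x # q) + shuffle_sum m (p @ y # q)"
  proof (induction p arbitrary: m)
    case Nil
    have "shuffle_sum (\<lambda>a b. m ((x + y) # a) b) q = shuffle_sum (\<lambda>a b. m (x # a) b + m (y # a) b) q"
    proof (rule shuffle_sum_cong)
      fix a b assume "set a \<union> set b = set q"
      with * show "m ((x + y) # a) b = m (x # a) b + m (y # a) b"
        using alt_add[OF Nil.prems(1)[of b], of "[]" a x y] by auto
    qed
    moreover have "shuffle_sum (\<lambda>a b. (-1) ^ length a * m a ((x + y) # b)) q =
        shuffle_sum (\<lambda>a b. (-1) ^ length a * m a (x # b) + (-1) ^ length a * m a (y # b)) q"
    proof (rule shuffle_sum_cong)
      fix a b assume "set a \<union> set b = set q"
      with * show "(-1) ^ length a * m a ((x + y) # b) =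
          (-1) ^ length a * m a (x # b) + (-1) ^ length a * m a (y # b)"
        using alt_add[OF Nil.prems(2)[of a], of "[]" b x y] by (auto simp flip: distrib_left)
    qed
    ultimately show ?case by (simp add: shuffle_sum_add)
  next
    case (Cons z p)
    have z: "z \<in> M" "set p \<subseteq> M" using Cons.prems by auto
    let ?m1 = "\<lambda>a b. m (z # a) b" and ?m2 = "\<lambda>a b. (-1) ^ length a * m a (z # b)"
    have "shuffle_sum ?m1 (p @ (x + y) # q) = shuffle_sum ?m1 (p @ x # q) + shuffle_sum ?m1 (p @ y # q)"
      using Cons.prems z by (intro Cons.IH) (auto intro: alt_Cons)
    moreover have "shuffle_sum ?m2 (p @ (x + y) # q) =
        shuffle_sum ?m2 (p @ x # q) + shuffle_sum ?m2 (p @ y # q)"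
      using Cons.prems z by (intro Cons.IH alt_cmult alt_length_mult) (auto intro: alt_Cons)
    ultimately show ?case by simp
  qed
next
  fix p q x assume *: "set p \<subseteq> M" "set q \<subseteq> M" "x \<in> M"
  from assms(1,2) *(1) show "shuffle_sum m (p @ x # x # q) = 0"
  proof (induction p arbitrary: m)
    case Nil
    have "shuffle_sum (\<lambda>a b. m (x # x # a) b) q = 0"
    proof (rule shuffle_sum_eq_0)
      fix a b assume "set a \<union> set b = set q"
      with * show "m (x # x # a) b = 0"
        using alt_adjacent[OF Nil.prems(1)[of b], of "[]" a x] by auto
    qed
    moreover have "shuffle_sum (\<lambda>a b. (-1) ^ length a * ((-1) ^ length a * m a (x # x # b))) q = 0"
    proof (rule shuffle_sum_eq_0)
      fix a b assume "set a \<union> set b = set q"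
      with * show "(-1) ^ length a * ((-1) ^ length a * m a (x # x # b)) = 0"
        using alt_adjacent[OF Nil.prems(2)[of a], of "[]" b x] by auto
    qed
    moreover have "shuffle_sum (\<lambda>a b. (-1) ^ length (x # a) * m (x # a) (x # b)) q =
        - shuffle_sum (\<lambda>a b. (-1) ^ length a * m (x # a) (x # b)) q"
      using shuffle_sum_cmult[of "-1" "\<lambda>a b. (-1) ^ length a * m (x # a) (x # b)" q] by simp
    ultimately show ?case by simp
  next
    case (Cons z p)
    have z: "z \<in> M" "set p \<subseteq> M" using Cons.prems by auto
    let ?m1 = "\<lambda>a b. m (z # a) b" and ?m2 = "\<lambda>a b. (-1) ^ length a * m a (z # b)"
    have "shuffle_sum ?m1 (p @ x # x # q) = 0"
      using Cons.prems z by (intro Cons.IH) (auto intro: alt_Cons)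
    moreover have "shuffle_sum ?m2 (p @ x # x # q) = 0"
      using Cons.prems z by (intro Cons.IH alt_cmult alt_length_mult) (auto intro: alt_Cons)
    ultimately show ?case by simp
  qed
qed

text \<open>Moving the chosen letter to the front costs exactly the shuffle sign, so each of the
  \<open>length u\<close> terms equals \<open>\<alpha> u\<close>. This factor is what builds up the
  factorials in powers of degree two classes.\<close>

lemma shuffle_sum_alt_singleton:
  fixes \<alpha> :: "'a::ab_group_add list \<Rightarrow> real"
  assumes "alt M \<alpha>" and M: "\<And>x y. x \<in> M \<Longrightarrow> y \<in> M \<Longrightarrow> x + y \<in> M" and "set u \<subseteq> M"
  shows "shuffle_sum (\<lambda>a b. if length a = 1 then \<alpha> (a @ b) else 0) u = length u * \<alpha> u"
  using assms(1,3)
proof (induction u arbitrary: \<alpha>)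
  case (Cons x u)
  have x: "x \<in> M" "set u \<subseteq> M" using Cons.prems by auto
  have "shuffle_sum (\<lambda>a b. if length (x # a) = 1 then \<alpha> ((x # a) @ b) else 0) u =
      shuffle_sum (\<lambda>a b. if a = [] then \<alpha> (x # b) else 0) u"
    by (rule shuffle_sum_cong) simp
  then have 1: "shuffle_sum (\<lambda>a b. if length (x # a) = 1 then \<alpha> ((x # a) @ b) else 0) u = \<alpha> (x # u)"
    by (simp only: shuffle_sum_Nil_left)
  have "shuffle_sum (\<lambda>a b. (-1) ^ length a * (if length a = 1 then \<alpha> (a @ x # b) else 0)) u =
      shuffle_sum (\<lambda>a b. if length a = 1 then \<alpha> (x # a @ b) else 0) u"
  proof (rule shuffle_sum_cong)
    fix a b assume "set a \<union> set b = set u"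
    then have "set a \<subseteq> M" "set b \<subseteq> M" using x by auto
    from alt_move_front[OF Cons.prems(1) M this x(1)]
    show "(-1) ^ length a * (if length a = 1 then \<alpha> (a @ x # b) else 0) =
        (if length a = 1 then \<alpha> (x # a @ b) else 0)"
      by simp
  qed
  also have "\<dots> = length u * \<alpha> (x # u)"
    using Cons.IH[OF alt_Cons[OF Cons.prems(1) x(1)] x(2)] by simp
  finally show ?case using 1 by (simp add: algebra_simps)
qed simp

section \<open>Top degree\<close>

text \<open>The last clause says that \<open>b\<close> generates \<open>M\<close>, in the only form in which this is needed.\<close>

definition zgenerated :: "nat \<Rightarrow> (nat \<Rightarrow> 'a::ab_group_add) \<Rightarrow> 'a set \<Rightarrow> bool" where
  "zgenerated g b M \<longleftrightarrow> (\<forall>i<g. b i \<in> M) \<and> (\<forall>x\<in>M. \<forall>y\<in>M. x + y \<in> M) \<and>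
     (\<forall>h :: 'a \<Rightarrow> real. (\<forall>x\<in>M. \<forall>y\<in>M. h (x + y) = h x + h y) \<longrightarrow> (\<forall>i<g. h (b i) = 0) \<longrightarrow>
        (\<forall>x\<in>M. h x = 0))"

lemma zgenerated_add: "zgenerated g b M \<Longrightarrow> x \<in> M \<Longrightarrow> y \<in> M \<Longrightarrow> x + y \<in> M"
  by (simp add: zgenerated_def)

lemma zgenerated_basis: "zgenerated g b M \<Longrightarrow> set (map b [0..<g]) \<subseteq> M"
  by (auto simp: zgenerated_def)

lemma zgenerated_eq_0:
  fixes h :: "'a::ab_group_add \<Rightarrow> real"
  assumes "zgenerated g b M" "\<And>x y. x \<in> M \<Longrightarrow> y \<in> M \<Longrightarrow> h (x + y) = h x + h y"
    and "\<And>i. i < g \<Longrightarrow> h (b i) = 0" "x \<in> M"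
  shows "h x = 0"
  using assms unfolding zgenerated_def by blast

text \<open>Additivity in the first entry reduces that entry to a basis vector; the remaining
  entries follow by induction.\<close>

lemma alt_eq_0_of_basis:
  assumes "zgenerated g b M" "alt M \<alpha>"
    and "\<And>w. length w = length u \<Longrightarrow> set w \<subseteq> b ` {..<g} \<Longrightarrow> \<alpha> w = 0" and "set u \<subseteq> M"
  shows "\<alpha> u = 0"
  using assms(2-)
proof (induction u arbitrary: \<alpha>)
  case (Cons x u)
  have "\<alpha> (b i # u) = 0" if "i < g" for i
  proof -
    have "b i \<in> M" using assms(1) that by (simp add: zgenerated_def)
    then show ?thesis
      using Cons.IH[of "\<lambda>u. \<alpha> (b i # u)"] Cons.prems that by (auto intro: alt_Cons)
  qed
  moreover have "\<alpha> ((x + y) # u) = \<alpha> (x # u) + \<alpha> (y # u)" if "x \<in> M" "y \<in> M" for x y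
    using alt_add[OF Cons.prems(1), of "[]" u x y] Cons.prems(3) that by simp
  ultimately show ?case
    using zgenerated_eq_0[OF assms(1), of "\<lambda>x. \<alpha> (x # u)" x] Cons.prems(3) by simp
qed simp

lemma alt_above_top:
  assumes "zgenerated g b M" "alt M \<alpha>" "g < length u" "set u \<subseteq> M"
  shows "\<alpha> u = 0"
proof (rule alt_eq_0_of_basis[OF assms(1,2) _ assms(4)])
  fix w assume w: "length w = length u" "set w \<subseteq> b ` {..<g}"
  have "card (set w) \<le> g"
    using card_mono[OF _ w(2)] card_image_le[of "{..<g}" b] by simp
  then have "\<not> distinct w" using distinct_card[of w] w assms(3) by auto
  then show "\<alpha> w = 0"
    using w assms(1) by (intro alt_repeated[OF assms(2)]) (auto simp: zgenerated_def)
qed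

lemma alt_top_eq_0:
  assumes "zgenerated g b M" "alt M \<alpha>" "length u = g" "set u \<subseteq> M" "\<alpha> (map b [0..<g]) = 0"
  shows "\<alpha> u = 0"
proof (rule alt_eq_0_of_basis[OF assms(1,2) _ assms(4)])
  fix w assume w: "length w = length u" "set w \<subseteq> b ` {..<g}"
  show "\<alpha> w = 0"
  proof (cases "distinct w")
    case True
    have "card (b ` {..<g}) \<le> g" using card_image_le[of "{..<g}" b] by simp
    then have sw: "set w = b ` {..<g}"
      using w True distinct_card[of w] assms(3) by (intro card_seteq) auto
    \<comment> \<open>Injectivity of \<open>b\<close> on the index range comes from counting: the
      \<open>g\<close> distinct entries of \<open>w\<close> already fill the image.\<close>
    then have "card (b ` {..<g}) = card {..<g}" using distinct_card[OF True] w assms(3) by simp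
    then have "inj_on b {..<g}" by (simp add: inj_on_iff_eq_card)
    then have "distinct (map b [0..<g])" by (simp add: distinct_map lessThan_atLeast0)
    then have "mset (map b [0..<g]) = mset w"
      using True sw by (subst set_eq_iff_mset_eq_distinct[symmetric]) (auto simp: lessThan_atLeast0)
    then show ?thesis
      using alt_mset[OF assms(2) _ zgenerated_basis[OF assms(1)]] assms(1,5) zgenerated_add by blast
  next
    case False
    then show ?thesis
      using w assms(1) by (intro alt_repeated[OF assms(2)]) (auto simp: zgenerated_def)
  qed
qed

text \<open>Top forms make up a space of dimension at most one: the difference of the two sides is a
  top form that vanishes on the basis. The cross-multiplied shape avoids division by a value that
  may be zero.\<close>

lemma alt_top_proportional:
  assumes "zgenerated g b M" "alt M \<alpha>" "alt M \<beta>" "length u = g" "set u \<subseteq> M"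
  shows "\<alpha> u * \<beta> (map b [0..<g]) = \<beta> u * \<alpha> (map b [0..<g])"
proof -
  have "alt M (\<lambda>u. \<beta> (map b [0..<g]) * \<alpha> u - \<alpha> (map b [0..<g]) * \<beta> u)"
    using assms by (intro alt_diff alt_cmult)
  from alt_top_eq_0[OF assms(1) this assms(4,5)] show ?thesis by (simp add: mult.commute)
qed

text \<open>The last entry \<open>x\<close> of \<open>v @ [x]\<close> is moved from \<open>\<tau>\<close> to \<open>\<alpha>\<close> by evaluating \<open>\<alpha> \<and> \<tau>(v, -)\<close>, which has
  degree \<open>g + 1\<close> and so vanishes, at \<open>(x, w)\<close>.\<close>

lemma wedge_contracted_top:
  assumes "zgenerated g b M" "alt M \<tau>" "alt M \<alpha>" "set v \<subseteq> M" "set w \<subseteq> M" "length w = g"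
    and "\<And>u. length u \<noteq> length v \<Longrightarrow> \<alpha> u = 0"
  shows "shuffle_sum (\<lambda>c d. \<alpha> c * \<tau> (v @ d)) w = \<alpha> v * \<tau> w"
  using assms(3,4,7)
proof (induction v arbitrary: \<alpha> rule: rev_induct)
  case Nil
  then have "shuffle_sum (\<lambda>c d. \<alpha> c * \<tau> ([] @ d)) w =
      shuffle_sum (\<lambda>c d. if c = [] then \<alpha> [] * \<tau> d else 0) w"
    by (intro shuffle_sum_cong) auto
  then show ?case by (simp only: shuffle_sum_Nil_left)
next
  case (snoc x v)
  let ?k = "length v"
  have x: "x \<in> M" "set v \<subseteq> M" using snoc.prems by auto
  have M: "\<And>x y. x \<in> M \<Longrightarrow> y \<in> M \<Longrightarrow> x + y \<in> M" using assms(1) by (rule zgenerated_add)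
  have "alt M (shuffle_sum (\<lambda>c d. \<alpha> c * \<tau> (v @ d)))"
  proof (rule alt_shuffle_sum[OF _ _ M])
    show "alt M (\<lambda>a. \<alpha> a * \<tau> (v @ b))" for b
      using alt_cmult[OF snoc.prems(1), of "\<tau> (v @ b)"] by (simp add: mult.commute)
    show "alt M (\<lambda>d. \<alpha> a * \<tau> (v @ d))" for a
      using assms(2) x by (intro alt_cmult alt_append)
  qed
  then have "shuffle_sum (\<lambda>c d. \<alpha> c * \<tau> (v @ d)) (x # w) = 0"
    using assms(5,6) x by (intro alt_above_top[OF assms(1)]) auto
  moreover have "shuffle_sum (\<lambda>c d. \<alpha> (x # c) * \<tau> (v @ d)) w = \<alpha> (x # v) * \<tau> w"
    using snoc.prems x by (intro snoc.IH alt_Cons) auto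
  \<comment> \<open>Where \<open>\<alpha>\<close> is nonzero, \<open>c\<close> has the length of
    \<open>v @ [x]\<close>; hence the sign is constant and can leave the sum.\<close>
  moreover have "shuffle_sum (\<lambda>c d. (-1) ^ length c * (\<alpha> c * \<tau> (v @ x # d))) w =
      shuffle_sum (\<lambda>c d. (-1) ^ Suc ?k * (\<alpha> c * \<tau> ((v @ [x]) @ d))) w"
  proof (rule shuffle_sum_cong)
    fix c d
    show "(-1) ^ length c * (\<alpha> c * \<tau> (v @ x # d)) = (-1) ^ Suc ?k * (\<alpha> c * \<tau> ((v @ [x]) @ d))"
      using snoc.prems(3)[of c] by (cases "length c = Suc ?k") auto
  qed
  ultimately have eq: "\<alpha> (x # v) * \<tau> w +
      (-1) ^ Suc ?k * shuffle_sum (\<lambda>c d. \<alpha> c * \<tau> ((v @ [x]) @ d)) w = 0"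
    unfolding shuffle_sum_cmult by simp
  have "\<alpha> (v @ [x]) = (-1) ^ ?k * \<alpha> (x # v)"
    using alt_move_front[OF snoc.prems(1) M x(2) _ x(1), of "[]"] by simp
  then show ?case
    using eq by (cases "even ?k") simp_all
qed

section \<open>Minors\<close>

text \<open>The wedge product of the one-forms \<open>f x\<close>, for \<open>x\<close> in
  \<open>u\<close>, evaluated at \<open>v\<close>. Unlike a matrix determinant it makes sense for
  lists of different lengths, where it is 0, so no length conditions are needed inside shuffle
  sums.\<close>

fun minor :: "('a \<Rightarrow> 'b \<Rightarrow> real) \<Rightarrow> 'a list \<Rightarrow> 'b list \<Rightarrow> real" where
  "minor f [] v = unit_form v"
| "minor f (x # u) v = shuffle_sum (\<lambda>a b. one_form UNIV (f x) a * minor f u b) v"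

lemma minor_length: "length u \<noteq> length v \<Longrightarrow> minor f u v = 0"
proof (induction u arbitrary: v)
  case (Cons x u)
  show ?case
    unfolding minor.simps
    by (rule shuffle_sum_eq_0) (use Cons in \<open>auto simp: one_form_def\<close>)
qed (auto simp: unit_form_def)

lemma minor_cong:
  assumes "\<And>x y. x \<in> set u \<Longrightarrow> y \<in> set v \<Longrightarrow> f x y = f' x y"
  shows "minor f u v = minor f' u v"
  using assms
proof (induction u arbitrary: v)
  case (Cons x u)
  show ?case
    unfolding minor.simps
  proof (rule shuffle_sum_cong)
    fix a b assume ab: "set a \<union> set b = set v"
    then have "minor f u b = minor f' u b" using Cons.prems by (intro Cons.IH) auto
    moreover have "one_form UNIV (f x) a = one_form UNIV (f' x) a"
      using ab Cons.prems by (cases a) (auto simp: one_form_def)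
    ultimately show "one_form UNIV (f x) a * minor f u b = one_form UNIV (f' x) a * minor f' u b"
      by simp
  qed
qed simp

lemma minor_map_left: "minor f (map h u) v = minor (\<lambda>x. f (h x)) u v"
  by (induction u arbitrary: v) simp_all

lemma minor_uminus: "minor (\<lambda>x y. - f x y) u v = (-1) ^ length u * minor f u v"
proof (induction u arbitrary: v)
  case (Cons x u)
  have "one_form UNIV (\<lambda>y. - f x y) a = - one_form UNIV (f x) a" for a
    by (simp add: one_form_def)
  then have "minor (\<lambda>x y. - f x y) (x # u) v =
      shuffle_sum (\<lambda>a b. (- ((-1) ^ length u)) * (one_form UNIV (f x) a * minor f u b)) v"
    by (simp add: Cons.IH mult_ac)
  then show ?case unfolding shuffle_sum_cmult by simp
qed simp

lemma minor_Ints: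
  assumes "\<And>x y. x \<in> set u \<Longrightarrow> y \<in> set v \<Longrightarrow> f x y \<in> \<int>"
  shows "minor f u v \<in> \<int>"
  using assms
proof (induction u arbitrary: v)
  case (Cons x u)
  show ?case
    unfolding minor.simps
  proof (intro shuffle_sum_Ints Ints_mult)
    fix a b assume "set a \<subseteq> set v" "set b \<subseteq> set v"
    then show "one_form UNIV (f x) a \<in> \<int>"
      using Cons.prems by (cases a) (auto simp: one_form_def)
    show "minor f u b \<in> \<int>"
      using Cons.prems \<open>set b \<subseteq> set v\<close> by (intro Cons.IH) auto
  qed
qed (simp add: unit_form_def)

text \<open>Laplace expansion along a block of rows, which in this encoding is associativity of the
  wedge product.\<close>

lemma minor_append:
  "minor f (u @ u') v = shuffle_sum (\<lambda>a b. minor f u a * minor f u' b) v"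
proof (induction u arbitrary: v)
  case Nil
  have "shuffle_sum (\<lambda>a b. minor f [] a * minor f u' b) v =
      shuffle_sum (\<lambda>a b. if a = [] then minor f u' b else 0) v"
    by (rule shuffle_sum_cong) (simp add: unit_form_def)
  then show ?case by (simp only: shuffle_sum_Nil_left append_Nil)
next
  case (Cons x u)
  have "minor f ((x # u) @ u') v = shuffle_sum (\<lambda>a b. shuffle_sum
      (\<lambda>c d. one_form UNIV (f x) a * (minor f u c * minor f u' d)) b) v"
    by (simp add: Cons.IH shuffle_sum_cmult)
  also have "\<dots> = shuffle_sum (\<lambda>a b. shuffle_sum
      (\<lambda>c d. one_form UNIV (f x) c * (minor f u d * minor f u' b)) a) v"
    by (rule shuffle_sum_assoc[symmetric])
  finally show ?case by (simp flip: mult.assoc add: shuffle_sum_cmult_right)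
qed

lemma alt_unit_form: "alt M unit_form"
  by (rule altI) (simp_all add: unit_form_def)

lemma alt_one_form:
  assumes "\<And>x y. x \<in> M \<Longrightarrow> y \<in> M \<Longrightarrow> h (x + y) = h x + h y"
  shows "alt M (one_form UNIV h)"
proof (rule altI)
  fix p q x y assume "x \<in> M" "y \<in> M"
  then show "one_form UNIV h (p @ (x + y) # q) = one_form UNIV h (p @ x # q) + one_form UNIV h (p @ y # q)"
    using assms by (cases p; cases q) (simp_all add: one_form_def)
qed (simp add: one_form_def)

lemma alt_minor_right:
  assumes "\<And>x y z. x \<in> set u \<Longrightarrow> y \<in> M \<Longrightarrow> z \<in> M \<Longrightarrow> f x (y + z) = f x y + f x z"
    and M: "\<And>x y. x \<in> M \<Longrightarrow> y \<in> M \<Longrightarrow> x + y \<in> M"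
  shows "alt M (minor f u)"
  using assms(1)
proof (induction u)
  case Nil
  have "minor f [] = unit_form" by (rule ext) simp
  then show ?case using alt_unit_form[of M] by simp
next
  case (Cons x u)
  have "alt M (shuffle_sum (\<lambda>a b. one_form UNIV (f x) a * minor f u b))"
  proof (rule alt_shuffle_sum[OF _ _ M])
    show "alt M (\<lambda>a. one_form UNIV (f x) a * minor f u b)" for b
      using alt_cmult[OF alt_one_form, of M "f x" "minor f u b"] Cons.prems by (simp add: mult.commute)
    show "alt M (\<lambda>b. one_form UNIV (f x) a * minor f u b)" for a
      using Cons by (intro alt_cmult) simp
  qed
  moreover have "minor f (x # u) = shuffle_sum (\<lambda>a b. one_form UNIV (f x) a * minor f u b)"
    by (rule ext) simp
  ultimately show ?case by simp
qed

text \<open>One-forms have odd degree, so graded commutativity equates the square with its own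
  negative.\<close>

lemma shuffle_sum_one_form_square: "shuffle_sum (\<lambda>a b. one_form UNIV h a * one_form UNIV h b) v = 0"
proof -
  let ?m = "\<lambda>a b. one_form UNIV h a * one_form UNIV h b"
  have "shuffle_sum ?m v = shuffle_sum (\<lambda>a b. ?m b a) v" by (simp add: mult.commute)
  also have "\<dots> = shuffle_sum (\<lambda>a b. (-1) ^ (length a * length b) * ?m a b) v"
    by (rule shuffle_sum_swap)
  also have "\<dots> = shuffle_sum (\<lambda>a b. (-1) * ?m a b) v"
    by (rule shuffle_sum_cong) (simp add: one_form_def)
  also have "\<dots> = - shuffle_sum ?m v" unfolding shuffle_sum_cmult by simp
  finally show ?thesis by simp
qed

text \<open>For two equal neighbouring rows, associativity groups their one-forms into a square,
  which is zero.\<close>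

lemma alt_minor_left:
  fixes f :: "'a::ab_group_add \<Rightarrow> 'b \<Rightarrow> real"
  assumes "\<And>x y z. x \<in> M \<Longrightarrow> y \<in> M \<Longrightarrow> z \<in> set v \<Longrightarrow> f (x + y) z = f x z + f y z"
  shows "alt M (\<lambda>u. minor f u v)"
proof (rule altI)
  fix p q x y assume *: "x \<in> M" "y \<in> M"
  have "minor f (p @ (x + y) # q) w = minor f (p @ x # q) w + minor f (p @ y # q) w"
    if "set w \<subseteq> set v" for w
    using that
  proof (induction p arbitrary: w)
    case Nil
    have "shuffle_sum (\<lambda>a b. one_form UNIV (f (x + y)) a * minor f q b) w =
        shuffle_sum (\<lambda>a b. one_form UNIV (f x) a * minor f q b + one_form UNIV (f y) a * minor f q b) w"
    proof (rule shuffle_sum_cong)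
      fix a b assume "set a \<union> set b = set w"
      then have "one_form UNIV (f (x + y)) a = one_form UNIV (f x) a + one_form UNIV (f y) a"
        using Nil * assms by (cases a) (auto simp: one_form_def)
      then show "one_form UNIV (f (x + y)) a * minor f q b =
          one_form UNIV (f x) a * minor f q b + one_form UNIV (f y) a * minor f q b"
        by (simp add: distrib_right)
    qed
    then show ?case by (simp add: shuffle_sum_add)
  next
    case (Cons z p)
    have "minor f ((z # p) @ (x + y) # q) w = shuffle_sum (\<lambda>a b.
        one_form UNIV (f z) a * minor f (p @ x # q) b + one_form UNIV (f z) a * minor f (p @ y # q) b) w"
      unfolding append_Cons minor.simps
    proof (rule shuffle_sum_cong)
      fix a b assume "set a \<union> set b = set w"
      then have "minor f (p @ (x + y) # q) b = minor f (p @ x # q) b + minor f (p @ y # q) b"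
        using Cons.prems by (intro Cons.IH) auto
      then show "one_form UNIV (f z) a * minor f (p @ (x + y) # q) b =
          one_form UNIV (f z) a * minor f (p @ x # q) b + one_form UNIV (f z) a * minor f (p @ y # q) b"
        by (simp add: distrib_left)
    qed
    then show ?case by (simp add: shuffle_sum_add)
  qed
  then show "minor f (p @ (x + y) # q) v = minor f (p @ x # q) v + minor f (p @ y # q) v"
    by simp
next
  fix p q x
  show "minor f (p @ x # x # q) v = 0"
  proof (induction p arbitrary: v)
    case Nil
    have "minor f (x # x # q) v = shuffle_sum (\<lambda>a b. shuffle_sum
        (\<lambda>c d. one_form UNIV (f x) a * (one_form UNIV (f x) c * minor f q d)) b) v"
      by (simp add: shuffle_sum_cmult)
    also have "\<dots> = shuffle_sum (\<lambda>a b. shuffle_sum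
        (\<lambda>c d. one_form UNIV (f x) c * (one_form UNIV (f x) d * minor f q b)) a) v"
      by (rule shuffle_sum_assoc[symmetric])
    also have "\<dots> = 0"
      by (simp flip: mult.assoc add: shuffle_sum_cmult_right shuffle_sum_one_form_square shuffle_sum_0)
    finally show ?case by simp
  qed (simp add: shuffle_sum_0)
qed

text \<open>This brings the recursion into the shape of a cofactor expansion along the first row,
  with position \<open>j\<close> deleted from the columns.\<close>

lemma shuffle_sum_one_form:
  "shuffle_sum (\<lambda>a b. one_form UNIV h a * \<beta> b) v =
   (\<Sum>j<length v. (-1) ^ j * h (v ! j) * \<beta> (take j v @ drop (Suc j) v))"
proof (induction v arbitrary: \<beta>)
  case (Cons y v)
  have "shuffle_sum (\<lambda>a b. one_form UNIV h (y # a) * \<beta> b) v =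
      shuffle_sum (\<lambda>a b. if a = [] then h y * \<beta> b else 0) v"
    by (rule shuffle_sum_cong) (simp add: one_form_def)
  then have 1: "shuffle_sum (\<lambda>a b. one_form UNIV h (y # a) * \<beta> b) v = h y * \<beta> v"
    by (simp only: shuffle_sum_Nil_left)
  have "shuffle_sum (\<lambda>a b. (-1) ^ length a * (one_form UNIV h a * \<beta> (y # b))) v =
      shuffle_sum (\<lambda>a b. (-1) * (one_form UNIV h a * \<beta> (y # b))) v"
    by (rule shuffle_sum_cong) (simp add: one_form_def)
  also have "\<dots> = - (\<Sum>j<length v. (-1) ^ j * h (v ! j) * \<beta> (y # take j v @ drop (Suc j) v))"
    unfolding shuffle_sum_cmult Cons.IH by simp
  finally show ?case
    using 1 by (simp add: sum.lessThan_Suc_shift sum_negf del: sum.lessThan_Suc)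
qed (simp add: one_form_def)

text \<open>The link to matrix determinants. It serves to identify \<open>det_chern\<close>, to
  evaluate the pairing of dual bases, and to obtain invariance under transposition, which the
  row-wise recursion hides.\<close>

lemma minor_eq_det:
  assumes "length u = n" "length v = n"
  shows "minor f u v = det (mat n n (\<lambda>(i, j). f (u ! i) (v ! j)))"
  using assms
proof (induction u arbitrary: n v)
  case Nil
  then show ?case by (simp add: unit_form_def)
next
  case (Cons x u)
  then obtain m where n: "n = Suc m" "length u = m" by auto
  let ?A = "mat n n (\<lambda>(i, j). f ((x # u) ! i) (v ! j))"
  have "det ?A = (\<Sum>j<n. ?A $$ (0, j) * cofactor ?A 0 j)"
    by (rule laplace_expansion_row) (simp_all add: n)
  also have "\<dots> = (\<Sum>j<n. (-1) ^ j * f x (v ! j) * minor f u (take j v @ drop (Suc j) v))"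
  proof (rule sum.cong)
    fix j assume j: "j \<in> {..<n}"
    let ?v = "take j v @ drop (Suc j) v"
    have "mat_delete ?A 0 j = mat m m (\<lambda>(i, k). f (u ! i) (?v ! k))"
      by (rule eq_matI) (use j n Cons.prems in \<open>auto simp: mat_delete_def nth_append\<close>)
    moreover have "minor f u ?v = det (mat m m (\<lambda>(i, k). f (u ! i) (?v ! k)))"
      using j n Cons.prems by (intro Cons.IH) auto
    ultimately show "?A $$ (0, j) * cofactor ?A 0 j = (-1) ^ j * f x (v ! j) * minor f u ?v"
      using j n by (simp add: cofactor_def)
  qed simp
  finally show ?case using Cons.prems by (simp add: shuffle_sum_one_form)
qed

lemma minor_transpose: "minor f u v = minor (\<lambda>x y. f y x) v u"
proof (cases "length u = length v")
  case True
  let ?n = "length v"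
  have "mat ?n ?n (\<lambda>(i, j). f (u ! j) (v ! i)) = transpose_mat (mat ?n ?n (\<lambda>(i, j). f (u ! i) (v ! j)))"
    by (rule eq_matI) auto
  then show ?thesis
    using True det_transpose[of "mat ?n ?n (\<lambda>(i, j). f (u ! i) (v ! j))" ?n]
    by (simp add: minor_eq_det[where n = ?n])
qed (simp add: minor_length)

section \<open>Powers and exponentials of degree two classes\<close>

text \<open>For a fixed choice of the single row \<open>a\<close>, Laplace expansion yields the
  minor of the reordered rows \<open>a @ b\<close>; all these choices contribute equally.\<close>

lemma minor_expansion:
  fixes f :: "'a::ab_group_add \<Rightarrow> 'b \<Rightarrow> real"
  assumes "\<And>x y z. f (x + y) z = f x z + f y z"
  shows "shuffle_sum (\<lambda>a b. shuffle_sum (\<lambda>c d. (if length a = 1 then minor f a c else 0) * minor f b d) v) u =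
    length u * minor f u v"
proof -
  have "shuffle_sum (\<lambda>a b. shuffle_sum (\<lambda>c d. (if length a = 1 then minor f a c else 0) * minor f b d) v) u =
      shuffle_sum (\<lambda>a b. if length a = 1 then minor f (a @ b) v else 0) u"
    by (rule shuffle_sum_cong) (simp add: minor_append shuffle_sum_0)
  also have "\<dots> = length u * minor f u v"
    using assms by (intro shuffle_sum_alt_singleton[of UNIV] alt_minor_left) simp_all
  finally show ?thesis .
qed

lemma c1_eq_minor:
  "c1 X L u v =
    (if length u = 1 \<and> set u \<subseteq> periods X \<and> set v \<subseteq> integral X then minor (chern L) u v else 0)"
proof (cases "length u = 1 \<and> length v = 1")
  case True
  then obtain x y where "u = [x]" "v = [y]" by (auto simp: length_Suc_conv)
  then show ?thesis by (simp add: c1_def unit_form_def one_form_def)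
qed (auto simp: c1_def minor_length)

text \<open>Each further factor splits off one row and multiplies by the number of rows, whence the
  factorial; the condition on the length of \<open>v\<close> is absorbed by the minor.\<close>

lemma cup_power_c1:
  assumes "\<And>x y z. chern L (x + y) z = chern L x z + chern L y z"
  shows "cup_power (c1 X L) k u v =
    (if length u = k \<and> set u \<subseteq> periods X \<and> set v \<subseteq> integral X then fact k * minor (chern L) u v else 0)"
proof (induction k arbitrary: u v)
  case 0
  then show ?case by (simp add: cup_power_def tensor_def unit_form_def)
next
  case (Suc k)
  let ?E = "minor (chern L)"
  have "cup_power (c1 X L) (Suc k) u v =
      shuffle_sum (\<lambda>a b. shuffle_sum (\<lambda>c d. c1 X L a c * cup_power (c1 X L) k b d) v) u"
    by (simp add: cup_power_def cup_eq_shuffle_sum)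
  also have "\<dots> = (if length u = Suc k \<and> set u \<subseteq> periods X \<and> set v \<subseteq> integral X
      then fact (Suc k) * ?E u v else 0)"
  proof (cases "length u = Suc k \<and> set u \<subseteq> periods X \<and> set v \<subseteq> integral X")
    case True
    have "shuffle_sum (\<lambda>a b. shuffle_sum (\<lambda>c d. c1 X L a c * cup_power (c1 X L) k b d) v) u =
        shuffle_sum (\<lambda>a b. shuffle_sum (\<lambda>c d.
          fact k * ((if length a = 1 then ?E a c else 0) * ?E b d)) v) u"
    proof (intro shuffle_sum_cong)
      fix a b c d
      assume "set a \<union> set b = set u" "length a + length b = length u" "set c \<union> set d = set v"
      then have "set a \<subseteq> periods X" "set b \<subseteq> periods X" "set c \<subseteq> integral X" "set d \<subseteq> integral X"
        "length a = 1 \<Longrightarrow> length b = k"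
        using True by auto
      then show "c1 X L a c * cup_power (c1 X L) k b d =
          fact k * ((if length a = 1 then ?E a c else 0) * ?E b d)"
        by (simp add: c1_eq_minor Suc.IH)
    qed
    also have "\<dots> = fact k * (length u * ?E u v)"
      unfolding shuffle_sum_cmult minor_expansion[OF assms] ..
    finally show ?thesis using True by simp
  next
    case False
    have "shuffle_sum (\<lambda>a b. shuffle_sum (\<lambda>c d. c1 X L a c * cup_power (c1 X L) k b d) v) u = 0"
    proof (intro shuffle_sum_eq_0)
      fix a b c d
      assume "set a \<union> set b = set u" "length a + length b = length u" "set c \<union> set d = set v"
      with False show "c1 X L a c * cup_power (c1 X L) k b d = 0"
        unfolding c1_eq_minor Suc.IH by auto
    qed
    then show ?thesis unfolding if_not_P[OF False] .
  qed
  finally show ?case .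
qed

section \<open>The exponential of the Chern class of the Poincare bundle\<close>

lemma sum_dual_basis:
  assumes "lattice_basis g b M" "linear f"
  shows "(\<Sum>i<g. dual_basis g b i x * f (b i)) = f x"
proof -
  have b: "inj_on b {..<g}" "independent (b ` {..<g})" "span (b ` {..<g}) = UNIV"
    using assms(1) by (auto simp: lattice_basis_def)
  have "x = (\<Sum>y\<in>b ` {..<g}. representation (b ` {..<g}) x y *\<^sub>R y)"
    using b by (intro real_vector.sum_representation_eq[symmetric]) auto
  also have "\<dots> = (\<Sum>i<g. dual_basis g b i x *\<^sub>R b i)"
    by (simp add: sum.reindex[OF b(1)] dual_basis_def)
  finally have "f x = f (\<Sum>i<g. dual_basis g b i x *\<^sub>R b i)" by simp
  then show ?thesis
    by (simp add: linear_sum[OF assms(2)] linear_cmul[OF assms(2)])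
qed

abbreviation pairing_minor :: "('a \<Rightarrow> real) list \<Rightarrow> 'a list \<Rightarrow> real" where
  "pairing_minor \<equiv> minor (\<lambda>f x. f x)"

text \<open>The sum of products of dual basis vectors is the evaluation pairing, by the expansion of
  a functional in the dual basis; from here on the bases disappear from the Poincare bundle.\<close>

lemma c1_poincare_summand:
  assumes "lattice_basis g b M"
  shows "(\<Sum>i<g. one_form M (dual_basis g b i) v * one_form (dual_lattice M) (\<lambda>f. f (b i)) s) =
    (if length s = 1 \<and> set v \<subseteq> M \<and> set s \<subseteq> dual_lattice M then pairing_minor s v else 0)"
proof (cases "length s = 1 \<and> length v = 1")
  case True
  then obtain f x where "s = [f]" "v = [x]" by (auto simp: length_Suc_conv)
  moreover have "f \<in> dual_lattice M \<Longrightarrow> (\<Sum>i<g. dual_basis g b i x * f (b i)) = f x"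
    using sum_dual_basis[OF assms, of f x] by (simp add: dual_lattice_def)
  ultimately show ?thesis
    by (cases "x \<in> M"; cases "f \<in> dual_lattice M") (simp_all add: one_form_def unit_form_def)
qed (auto simp: one_form_def minor_length)

lemma c1_poincare_eq_minors:
  assumes "lattice_basis (tdim X) (pbasis X) (periods X)" "lattice_basis (tdim X) (ibasis X) (integral X)"
  shows "c1_poincare X u v s t =
    - (if u = [] \<and> t = [] \<and> length s = 1 \<and> set v \<subseteq> integral X \<and> set s \<subseteq> dual_lattice (integral X)
       then pairing_minor s v else 0)
    - (if v = [] \<and> s = [] \<and> length t = 1 \<and> set u \<subseteq> periods X \<and> set t \<subseteq> dual_lattice (periods X)
       then pairing_minor t u else 0)"
proof -
  have sum_apply: "(\<Sum>i<n. F i) u v s t = (\<Sum>i<n. F i u v s t)"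
    for F :: "nat \<Rightarrow> ('a, 'a \<Rightarrow> real) kform" and n
    by (induction n) simp_all
  have "c1_poincare X u v s t =
      - (unit_form u * unit_form t * (\<Sum>i<tdim X. one_form (integral X) (dual_basis (tdim X) (ibasis X) i) v *
           one_form (dual_lattice (integral X)) (\<lambda>f. f (ibasis X i)) s))
      - (unit_form v * unit_form s * (\<Sum>i<tdim X. one_form (periods X) (dual_basis (tdim X) (pbasis X) i) u *
           one_form (dual_lattice (periods X)) (\<lambda>f. f (pbasis X i)) t))"
    by (simp add: c1_poincare_def sum_apply ktensor_def tensor_def sum_distrib_left mult_ac)
  then show ?thesis
    unfolding c1_poincare_summand[OF assms(1)] c1_poincare_summand[OF assms(2)]
    by (cases "u = []"; cases "t = []"; cases "v = []"; cases "s = []") (simp_all add: unit_form_def)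
qed

text \<open>The sign is \<open>(-1)\<^sup>n\<close> from the two minus signs in \<open>c\<^sub>1(\<P>)\<close> times \<open>(-1)\<^bsup>n(n-1)/2\<^esup>\<close> from sorting
  a product of \<open>n\<close> tensors of odd classes.\<close>

lemma kpower_c1_poincare:
  assumes "lattice_basis (tdim X) (pbasis X) (periods X)" "lattice_basis (tdim X) (ibasis X) (integral X)"
  shows "kpower (c1_poincare X) n u v s t =
    (if length u + length v = n \<and> set u \<subseteq> periods X \<and> set v \<subseteq> integral X \<and>
        set s \<subseteq> dual_lattice (integral X) \<and> set t \<subseteq> dual_lattice (periods X)
     then fact n * (-1) ^ (n * (n + 1) div 2) * (pairing_minor s v * pairing_minor t u) else 0)"
    (is "_ = (if ?P n u v s t then _ else 0)")
proof (induction n arbitrary: u v s t)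
  case 0
  then show ?case by (auto simp: kpower_def kunit_def ktensor_def tensor_def unit_form_def minor_length)
next
  case (Suc n)
  let ?W = pairing_minor
  \<comment> \<open>The factors are the minus sign in c1(P), the sign (-1)^n of moving a class of
    degree 1 past one of degree \<open>n\<close>, and the constant of the \<open>n\<close>-th
    power.\<close>
  let ?K = "- ((-1) ^ n) * (fact n * (-1) ^ (n * (n + 1) div 2)) :: real"
  let ?T = "\<lambda>u1 u2 v1 v2 s1 s2 t1 t2. (-1) ^ ((length u1 + length v1) * (length s2 + length t2)) *
       c1_poincare X u1 v1 s1 t1 * kpower (c1_poincare X) n u2 v2 s2 t2"
  have step: "kpower (c1_poincare X) (Suc n) u v s t =
      shuffle_sum (\<lambda>u1 u2. shuffle_sum (\<lambda>v1 v2. shuffle_sum (\<lambda>s1 s2. shuffle_sum (\<lambda>t1 t2.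
        ?T u1 u2 v1 v2 s1 s2 t1 t2) t) s) v) u"
    by (simp add: kpower_def kprod_eq_shuffle_sum)
  show ?case
  proof (cases "?P (Suc n) u v s t")
    case True
    \<comment> \<open>In \<open>?A\<close> the new factor pairs \<open>s\<close> with
      \<open>v\<close>, in \<open>?B\<close> it pairs \<open>t\<close> with \<open>u\<close>. The
      conditions are nested so that each empty block can be removed by its own use of
      \<open>shuffle_sum_Nil_left\<close>.\<close>
    let ?A = "\<lambda>u1 u2 v1 v2 s1 s2 t1 t2. if u1 = [] then if t1 = [] then
        (if length s1 = 1 then ?W s1 v1 else 0) * ?W s2 v2 * ?W t2 u2 else 0 else 0"
    let ?B = "\<lambda>u1 u2 v1 v2 s1 s2 t1 t2. if v1 = [] then if s1 = [] then
        (if length t1 = 1 then ?W t1 u1 else 0) * ?W t2 u2 * ?W s2 v2 else 0 else 0"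
    have "kpower (c1_poincare X) (Suc n) u v s t =
        shuffle_sum (\<lambda>u1 u2. shuffle_sum (\<lambda>v1 v2. shuffle_sum (\<lambda>s1 s2. shuffle_sum (\<lambda>t1 t2.
          ?K * (?A u1 u2 v1 v2 s1 s2 t1 t2 + ?B u1 u2 v1 v2 s1 s2 t1 t2)) t) s) v) u"
      unfolding step
    proof (intro shuffle_sum_cong)
      fix u1 u2 v1 v2 s1 s2 t1 t2
      assume "set u1 \<union> set u2 = set u" and lu: "length u1 + length u2 = length u"
        and "set v1 \<union> set v2 = set v" and lv: "length v1 + length v2 = length v"
        and "set s1 \<union> set s2 = set s" "set t1 \<union> set t2 = set t"
      then have sub: "set u1 \<subseteq> periods X" "set u2 \<subseteq> periods X" "set v1 \<subseteq> integral X" "set v2 \<subseteq> integral X"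
        "set s1 \<subseteq> dual_lattice (integral X)" "set s2 \<subseteq> dual_lattice (integral X)"
        "set t1 \<subseteq> dual_lattice (periods X)" "set t2 \<subseteq> dual_lattice (periods X)"
        using True by auto
      have T: "?T u1 u2 v1 v2 s1 s2 t1 t2 =
          (-1) ^ ((length u1 + length v1) * (length s2 + length t2)) * c1_poincare X u1 v1 s1 t1 *
          (if length u2 + length v2 = n
           then fact n * (-1) ^ (n * (n + 1) div 2) * (?W s2 v2 * ?W t2 u2) else 0)"
        using sub by (simp add: Suc.IH)
      have C: "c1_poincare X u1 v1 s1 t1 =
          - (if u1 = [] \<and> t1 = [] \<and> length s1 = 1 then ?W s1 v1 else 0)
          - (if v1 = [] \<and> s1 = [] \<and> length t1 = 1 then ?W t1 u1 else 0)"
        using sub by (simp add: c1_poincare_eq_minors[OF assms])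
      show "?T u1 u2 v1 v2 s1 s2 t1 t2 =
          ?K * (?A u1 u2 v1 v2 s1 s2 t1 t2 + ?B u1 u2 v1 v2 s1 s2 t1 t2)"
      proof (cases "length s2 = length v2 \<and> length t2 = length u2")
        case len2: True
        show ?thesis
        proof (cases "u1 = [] \<and> t1 = [] \<and> length s1 = 1 \<and> length v1 = 1")
          case c: True
          then have "length u2 + length v2 = n" "length s2 + length t2 = n" "s1 \<noteq> []"
            using len2 lu lv True by auto
          with c show ?thesis unfolding T unfolding C by simp
        next
          case nc: False
          show ?thesis
          proof (cases "v1 = [] \<and> s1 = [] \<and> length t1 = 1 \<and> length u1 = 1")
            case c: True
            then have "length u2 + length v2 = n" "length s2 + length t2 = n" "t1 \<noteq> []"
              using len2 lu lv True by auto
            with c show ?thesis unfolding T unfolding C by simp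
          next
            case False
            have z: "(if u1 = [] \<and> t1 = [] \<and> length s1 = 1 then ?W s1 v1 else 0) = 0"
              "(if v1 = [] \<and> s1 = [] \<and> length t1 = 1 then ?W t1 u1 else 0) = 0"
              using nc False minor_length[of s1 v1 "\<lambda>f x. f x"] minor_length[of t1 u1 "\<lambda>f x. f x"]
              by (auto split: if_splits)
            have "?A u1 u2 v1 v2 s1 s2 t1 t2 = (if u1 = [] \<and> t1 = [] \<and> length s1 = 1 then ?W s1 v1 else 0) *
                ?W s2 v2 * ?W t2 u2" by simp
            moreover have "?B u1 u2 v1 v2 s1 s2 t1 t2 =
                (if v1 = [] \<and> s1 = [] \<and> length t1 = 1 then ?W t1 u1 else 0) * ?W t2 u2 * ?W s2 v2" by simp
            ultimately show ?thesis unfolding T unfolding C z by simp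
          qed
        qed
      next
        case False
        then have "?W s2 v2 = 0 \<or> ?W t2 u2 = 0" using minor_length by blast
        then show ?thesis unfolding T by auto
      qed
    qed
    also have "\<dots> = ?K * (
        shuffle_sum (\<lambda>u1 u2. shuffle_sum (\<lambda>v1 v2. shuffle_sum (\<lambda>s1 s2. shuffle_sum (\<lambda>t1 t2.
          ?A u1 u2 v1 v2 s1 s2 t1 t2) t) s) v) u +
        shuffle_sum (\<lambda>u1 u2. shuffle_sum (\<lambda>v1 v2. shuffle_sum (\<lambda>s1 s2. shuffle_sum (\<lambda>t1 t2.
          ?B u1 u2 v1 v2 s1 s2 t1 t2) t) s) v) u)"
      unfolding shuffle_sum_cmult shuffle_sum_add ..
    also have "shuffle_sum (\<lambda>u1 u2. shuffle_sum (\<lambda>v1 v2. shuffle_sum (\<lambda>s1 s2. shuffle_sum (\<lambda>t1 t2.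
          ?A u1 u2 v1 v2 s1 s2 t1 t2) t) s) v) u =
        shuffle_sum (\<lambda>v1 v2. shuffle_sum (\<lambda>s1 s2.
          (if length s1 = 1 then ?W s1 v1 else 0) * ?W s2 v2 * ?W t u) s) v"
    proof -
      have *: "shuffle_sum (\<lambda>v1 v2. shuffle_sum (\<lambda>s1 s2. shuffle_sum (\<lambda>t1 t2.
          ?A u1 u2 v1 v2 s1 s2 t1 t2) t) s) v = (if u1 = [] then
          shuffle_sum (\<lambda>v1 v2. shuffle_sum (\<lambda>s1 s2.
          (if length s1 = 1 then ?W s1 v1 else 0) * ?W s2 v2 * ?W t u2) s) v else 0)" for u1 u2
        by (cases "u1 = []") (simp_all only: shuffle_sum_Nil_left if_True if_False simp_thms shuffle_sum_0)
      show ?thesis unfolding * by (rule shuffle_sum_Nil_left)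
    qed
    also have "\<dots> = length s * ?W s v * ?W t u"
      unfolding shuffle_sum_cmult_right
      by (subst shuffle_sum_commute, subst minor_expansion) simp_all
    also have "shuffle_sum (\<lambda>u1 u2. shuffle_sum (\<lambda>v1 v2. shuffle_sum (\<lambda>s1 s2. shuffle_sum (\<lambda>t1 t2.
          ?B u1 u2 v1 v2 s1 s2 t1 t2) t) s) v) u =
        shuffle_sum (\<lambda>u1 u2. shuffle_sum (\<lambda>t1 t2.
          (if length t1 = 1 then ?W t1 u1 else 0) * ?W t2 u2 * ?W s v) t) u"
    proof -
      have 1: "shuffle_sum (\<lambda>t1 t2. ?B u1 u2 v1 v2 s1 s2 t1 t2) t = (if v1 = [] then if s1 = [] then
          shuffle_sum (\<lambda>t1 t2. (if length t1 = 1 then ?W t1 u1 else 0) * ?W t2 u2) t * ?W s2 v2 else 0 else 0)"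
        for u1 u2 v1 v2 s1 s2
        by (simp add: shuffle_sum_0 shuffle_sum_cmult_right del: One_nat_def)
      have 2: "shuffle_sum (\<lambda>s1 s2. if v1 = [] then if s1 = [] then c * ?W s2 v2 else 0 else 0) s =
          (if v1 = [] then c * ?W s v2 else 0)" for v1 v2 c
        using shuffle_sum_Nil_left[of "\<lambda>s2. c * ?W s2 v2" s] by (simp add: shuffle_sum_0)
      show ?thesis unfolding 1 2 shuffle_sum_Nil_left shuffle_sum_cmult_right ..
    qed
    also have "\<dots> = length t * ?W t u * ?W s v"
      unfolding shuffle_sum_cmult_right
      by (subst shuffle_sum_commute, subst minor_expansion) simp_all
    finally have eq: "kpower (c1_poincare X) (Suc n) u v s t =
        ?K * (length s * ?W s v * ?W t u + length t * ?W t u * ?W s v)" .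
    \<comment> \<open>Successive triangular numbers differ by \<open>n + 1\<close>, which accounts
      exactly for the sign in \<open>?K\<close>.\<close>
    have sgn: "(-1) ^ (Suc n * (Suc n + 1) div 2) = (-1) ^ (n * (n + 1) div 2) * - ((-1) ^ n :: real)"
    proof -
      have "Suc n * (Suc n + 1) = n * (n + 1) + (n + 1) * 2" by simp
      then have "Suc n * (Suc n + 1) div 2 = n * (n + 1) div 2 + (n + 1)"
        by (simp only: div_mult_self1 zero_neq_numeral not_False_eq_True)
      then show ?thesis by (simp add: power_add)
    qed
    show ?thesis
    proof (cases "length s = length v \<and> length t = length u")
      case len: True
      \<comment> \<open>The two expansions contribute \<open>length s\<close> and
        \<open>length t\<close>; nonzero minors make these the lengths of \<open>v\<close> and
        \<open>u\<close>, so together they give the factor \<open>n + 1\<close> of the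
        factorial.\<close>
      then have "real (length s) + real (length t) = real (Suc n)" using True by linarith
      then have "length s * ?W s v * ?W t u + length t * ?W t u * ?W s v = Suc n * (?W s v * ?W t u)"
        by (metis (no_types, lifting) distrib_right mult.assoc mult.commute)
      then show ?thesis
        unfolding eq sgn if_P[OF True] by (simp only: fact_Suc of_nat_mult mult_ac)
    next
      case False
      then have "?W s v = 0 \<or> ?W t u = 0" using minor_length by blast
      then show ?thesis using eq by auto
    qed
  next
    case False
    have "shuffle_sum (\<lambda>u1 u2. shuffle_sum (\<lambda>v1 v2. shuffle_sum (\<lambda>s1 s2. shuffle_sum (\<lambda>t1 t2.
        ?T u1 u2 v1 v2 s1 s2 t1 t2) t) s) v) u = 0"
    proof (intro shuffle_sum_eq_0)
      fix u1 u2 v1 v2 s1 s2 t1 t2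
      assume *: "set u1 \<union> set u2 = set u" "length u1 + length u2 = length u"
        "set v1 \<union> set v2 = set v" "length v1 + length v2 = length v"
        "set s1 \<union> set s2 = set s" "set t1 \<union> set t2 = set t"
      show "?T u1 u2 v1 v2 s1 s2 t1 t2 = 0"
      proof (rule ccontr)
        assume "?T u1 u2 v1 v2 s1 s2 t1 t2 \<noteq> 0"
        then have "c1_poincare X u1 v1 s1 t1 \<noteq> 0" "kpower (c1_poincare X) n u2 v2 s2 t2 \<noteq> 0" by auto
        moreover have "length s1 = length v1" if "?W s1 v1 \<noteq> 0" using that minor_length by blast
        moreover have "length t1 = length u1" if "?W t1 u1 \<noteq> 0" using that minor_length by blast
        ultimately have "?P n u2 v2 s2 t2" "?P 1 u1 v1 s1 t1"
          unfolding Suc.IH c1_poincare_eq_minors[OF assms] by (force split: if_splits)+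
        then have "?P (Suc n) u v s t" using * by auto
        with False show False by blast
      qed
    qed
    then show ?thesis unfolding step if_not_P[OF False] .
  qed
qed

text \<open>On given arguments only the power of exponent \<open>length u + length v\<close> can be
  nonzero, so the exponential series is a single term and its factorial cancels.\<close>

lemma kexp_c1_poincare:
  assumes "lattice_basis (tdim X) (pbasis X) (periods X)" "lattice_basis (tdim X) (ibasis X) (integral X)"
  shows "kexp (c1_poincare X) u v s t =
    (if set u \<subseteq> periods X \<and> set v \<subseteq> integral X \<and>
        set s \<subseteq> dual_lattice (integral X) \<and> set t \<subseteq> dual_lattice (periods X)
     then (-1) ^ ((length u + length v) * (length u + length v + 1) div 2) *
       (pairing_minor s v * pairing_minor t u) else 0)"
proof -
  let ?n = "length u + length v"
  have "kexp (c1_poincare X) u v s t = (\<Sum>k\<in>{?n}. kpower (c1_poincare X) k u v s t / fact k)"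
    unfolding kexp_def by (rule suminf_finite) (auto simp: kpower_c1_poincare[OF assms])
  then show ?thesis by (simp add: kpower_c1_poincare[OF assms])
qed

text \<open>A class pulled back from the first factor has degree 0 in the second, so the sign in the
  product is trivial and \<open>s\<close>, \<open>t\<close> become mere parameters of a cup product
  on \<open>X\<close>.\<close>

lemma fourier_mukai_eq_cup:
  "fourier_mukai X \<alpha> s t = delta X (cup (\<lambda>a c. kexp (c1_poincare X) a c s t) \<alpha>)"
proof -
  let ?K = "kexp (c1_poincare X)"
  have "kprod ?K (proj1_pull \<alpha>) u v s t = cup (\<lambda>a c. ?K a c s t) \<alpha> u v" for u v
  proof -
    have "kprod ?K (proj1_pull \<alpha>) u v s t =
        shuffle_sum (\<lambda>u1 u2. shuffle_sum (\<lambda>v1 v2. shuffle_sum (\<lambda>s1 s2. shuffle_sum (\<lambda>t1 t2.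
          if t2 = [] then if s2 = [] then ?K u1 v1 s1 t1 * \<alpha> u2 v2 else 0 else 0) t) s) v) u"
      unfolding kprod_eq_shuffle_sum
      by (intro shuffle_sum_cong) (simp add: proj1_pull_def ktensor_def tensor_def unit_form_def)
    then show ?thesis by (simp only: shuffle_sum_Nil_right cup_eq_shuffle_sum)
  qed
  then show ?thesis by (simp add: fourier_mukai_def proj2_push_def delta_def)
qed

section \<open>Lattices and their duals\<close>

text \<open>The operation \<open>m\<close> stands for integer multiples, as neither \<open>*\<^sub>R\<close> nor any other scalar
  multiplication is available on function spaces.\<close>

lemma zgeneratedI:
  fixes m :: "int \<Rightarrow> 'a::ab_group_add \<Rightarrow> 'a"
  assumes b: "\<And>i. i < g \<Longrightarrow> b i \<in> M" and add: "\<And>x y. x \<in> M \<Longrightarrow> y \<in> M \<Longrightarrow> x + y \<in> M"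
    and minus: "\<And>x. x \<in> M \<Longrightarrow> - x \<in> M"
    and m0: "\<And>x. m 0 x = 0" and m1: "\<And>k x. m (k + 1) x = m k x + x"
    and gen: "\<And>x. x \<in> M \<Longrightarrow> \<exists>c. x = (\<Sum>i<g. m (c i) (b i))"
  shows "zgenerated g b M"
  unfolding zgenerated_def
proof (intro conjI allI impI ballI)
  fix h :: "'a \<Rightarrow> real" and x
  assume h: "\<forall>x\<in>M. \<forall>y\<in>M. h (x + y) = h x + h y" and hb: "\<forall>i<g. h (b i) = 0" and x: "x \<in> M"
  define K where "K = {x \<in> M. h x = 0}"
  have 0: "0 \<in> M" using add[OF x minus[OF x]] by simp
  have h0: "h 0 = 0" using h[rule_format, OF 0 0] by simp
  have K0: "0 \<in> K" using 0 h0 by (simp add: K_def)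
  have Kadd: "x + y \<in> K" if "x \<in> K" "y \<in> K" for x y
    using that add h by (simp add: K_def)
  have Kminus: "- x \<in> K" if "x \<in> K" for x
    using that minus[of x] h[rule_format, of x "- x"] h0 by (simp add: K_def)
  have Km: "m k y \<in> K" if "y \<in> K" for k y
  proof (induction k rule: int_induct[where k = 0])
    case (step2 i)
    have "m (i - 1) y = m i y + - y" using m1[of "i - 1" y] by simp
    then show ?case using Kadd[OF step2(2) Kminus[OF that]] by simp
  qed (simp_all add: m0 m1 K0 Kadd that)
  obtain c where c: "x = (\<Sum>i<g. m (c i) (b i))" using gen[OF x] by blast
  have "(\<Sum>i<n. m (c i) (b i)) \<in> K" if "n \<le> g" for n
    using that
  proof (induction n)
    case (Suc n)
    then have "b n \<in> K" using b hb by (simp add: K_def)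
    then show ?case using Suc by (simp add: Kadd Km)
  qed (simp add: K0)
  from this[of g] c show "h x = 0" by (simp add: K_def)
qed (use b add in auto)

lemma zgenerated_lattice:
  assumes "lattice_basis g b M"
  shows "zgenerated g b M"
proof (rule zgeneratedI[where m = "\<lambda>k x. real_of_int k *\<^sub>R x"])
  have M: "x \<in> M \<longleftrightarrow> (\<exists>c. x = (\<Sum>i<g. real_of_int (c i) *\<^sub>R b i))" for x
    using assms by (simp add: lattice_basis_def)
  show "b i \<in> M" if "i < g" for i
  proof -
    have "(\<Sum>j<g. real_of_int (if j = i then 1 else 0) *\<^sub>R b j) = (\<Sum>j<g. if j = i then b j else 0)"
      by (rule sum.cong) auto
    also have "\<dots> = b i" using that by simp
    finally show ?thesis unfolding M by (intro exI[of _ "\<lambda>j. if j = i then 1 else 0"]) simp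
  qed
  fix x assume "x \<in> M"
  then obtain c where c: "x = (\<Sum>i<g. real_of_int (c i) *\<^sub>R b i)" using M by blast
  show "- x \<in> M" unfolding M c
    by (intro exI[of _ "\<lambda>i. - c i"]) (simp add: sum_negf)
  show "\<exists>c. x = (\<Sum>i<g. real_of_int (c i) *\<^sub>R b i)" using c by blast
  fix y assume "y \<in> M"
  then obtain d where d: "y = (\<Sum>i<g. real_of_int (d i) *\<^sub>R b i)" using M by blast
  show "x + y \<in> M" unfolding M c d
    by (intro exI[of _ "\<lambda>i. c i + d i"]) (simp add: sum.distrib scaleR_add_left)
qed (simp_all add: scaleR_add_left)

lemma dual_basis_basis:
  assumes "lattice_basis g b M" "i < g" "j < g"
  shows "dual_basis g b i (b j) = (if i = j then 1 else 0)"
proof -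
  have "inj_on b {..<g}" "independent (b ` {..<g})" using assms by (auto simp: lattice_basis_def)
  moreover from this have "b i = b j \<longleftrightarrow> i = j" using assms by (auto dest: inj_onD)
  ultimately show ?thesis
    using assms by (simp add: dual_basis_def real_vector.representation_basis)
qed

lemma linear_dual_basis:
  assumes "lattice_basis g b M"
  shows "linear (dual_basis g b i)"
  using assms unfolding dual_basis_def lattice_basis_def
  by (intro linearI) (simp_all add: real_vector.representation_add real_vector.representation_scale)

lemma dual_basis_in_dual_lattice:
  assumes "lattice_basis g b M" "i < g"
  shows "dual_basis g b i \<in> dual_lattice M"
proof -
  note lin = linear_dual_basis[OF assms(1), of i]
  have "dual_basis g b i x \<in> \<int>" if "x \<in> M" for x
  proof -
    obtain c :: "nat \<Rightarrow> int" where "x = (\<Sum>j<g. real_of_int (c j) *\<^sub>R b j)"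
      using assms(1) \<open>x \<in> M\<close> by (auto simp: lattice_basis_def)
    then have "dual_basis g b i x = (\<Sum>j<g. real_of_int (c j) * dual_basis g b i (b j))"
      by (simp add: linear_sum[OF lin] linear_cmul[OF lin])
    also have "\<dots> \<in> \<int>" using assms by (intro Ints_sum Ints_mult) (auto simp: dual_basis_basis)
    finally show ?thesis .
  qed
  with lin show ?thesis by (simp add: dual_lattice_def)
qed

text \<open>A functional \<open>f\<close> in the dual lattice has the integers
  \<open>f (b i)\<close> as its coefficients in the dual basis.\<close>

lemma zgenerated_dual_lattice:
  assumes "lattice_basis g b M"
  shows "zgenerated g (dual_basis g b) (dual_lattice M)"
proof (rule zgeneratedI[where m = "\<lambda>k f x. real_of_int k * f x"])
  fix f assume f: "f \<in> dual_lattice M"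
  then have lin: "linear f" by (simp add: dual_lattice_def)
  have "linear (\<lambda>x. - f x)" using lin by (rule linear_compose_neg)
  then show "- f \<in> dual_lattice M" using f by (simp add: dual_lattice_def fun_Compl_def)
  have "f (b i) \<in> \<int>" if "i < g" for i
    using f zgenerated_lattice[OF assms] that by (simp add: dual_lattice_def zgenerated_def)
  then have "\<forall>i. \<exists>c. i < g \<longrightarrow> f (b i) = real_of_int c" by (auto elim!: Ints_cases)
  then obtain c where c: "\<And>i. i < g \<Longrightarrow> f (b i) = real_of_int (c i)" by metis
  have sum_apply: "(\<Sum>i<n. F i) x = (\<Sum>i<n. F i x)" for F :: "nat \<Rightarrow> 'a \<Rightarrow> real" and n x
    by (induction n) simp_all
  have "f x = (\<Sum>i<g. (\<lambda>x. real_of_int (c i) * dual_basis g b i x)) x" for x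
    using sum_dual_basis[OF assms lin, of x] c by (simp add: sum_apply mult.commute)
  then show "\<exists>c. f = (\<Sum>i<g. (\<lambda>x. real_of_int (c i) * dual_basis g b i x))" by blast
  fix f' assume "f' \<in> dual_lattice M"
  then show "f + f' \<in> dual_lattice M"
    using f linear_compose_add[of f f'] by (simp add: dual_lattice_def plus_fun_def)
qed (auto simp: dual_basis_in_dual_lattice[OF assms] distrib_right)

lemma dual_lattice_Ints: "f \<in> dual_lattice M \<Longrightarrow> x \<in> M \<Longrightarrow> f x \<in> \<int>"
  by (simp add: dual_lattice_def)

text \<open>The matrix is the identity. Pairing with a lattice basis is thus a normalised volume
  form on the dual lattice.\<close>

lemma pairing_minor_dual_basis:
  assumes "lattice_basis g b M"
  shows "pairing_minor (map (dual_basis g b) [0..<g]) (map b [0..<g]) = 1"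
proof -
  have "mat g g (\<lambda>(i, j). (map (dual_basis g b) [0..<g] ! i) (map b [0..<g] ! j)) = (1\<^sub>m g :: real mat)"
    by (rule eq_matI) (auto simp: dual_basis_basis[OF assms])
  then show ?thesis by (simp add: minor_eq_det[where n = g])
qed

text \<open>A kernel vector of the matrix gives coefficients, in the basis of N, of a vector
  \<open>y\<close> orthogonal to all \<lambda>_i, hence to everything; nondegeneracy makes it
  zero.\<close>

lemma det_chern_nonzero:
  assumes "real_torus X" "tropical_line_bundle X L" "nondegenerate L"
  shows "det_chern X L \<noteq> 0"
proof
  let ?g = "tdim X" and ?E = "chern L"
  let ?A = "mat ?g ?g (\<lambda>(i, j). ?E (pbasis X i) (ibasis X j))"
  assume "det_chern X L = 0"
  then have "det ?A = 0" by (simp add: det_chern_def)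
  then obtain v where v: "v \<in> carrier_vec ?g" "v \<noteq> 0\<^sub>v ?g" "?A *\<^sub>v v = 0\<^sub>v ?g"
    using det_0_iff_vec_prod_zero[of ?A ?g] by auto
  have lp: "lattice_basis ?g (pbasis X) (periods X)" and li: "lattice_basis ?g (ibasis X) (integral X)"
    using assms(1) by (auto simp: real_torus_def)
  have lin: "linear (?E x)" "linear (\<lambda>x. ?E x y)" and sym: "?E x y = ?E y x" for x y
    using assms(2) by (auto simp: tropical_line_bundle_def)
  define y where "y = (\<Sum>j<?g. v $ j *\<^sub>R ibasis X j)"
  have "?E (pbasis X i) y = 0" if "i < ?g" for i
  proof -
    have "?E (pbasis X i) y = (\<Sum>j<?g. v $ j * ?E (pbasis X i) (ibasis X j))"
      by (simp add: y_def linear_sum[OF lin(1)] linear_cmul[OF lin(1)])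
    also have "\<dots> = (?A *\<^sub>v v) $ i"
      using that v(1) by (simp add: scalar_prod_def lessThan_atLeast0 mult.commute)
    finally show ?thesis using that v(3) by simp
  qed
  then have "?E x y = 0" for x
    using sum_dual_basis[OF lp lin(2), of x y] by simp
  then have "y = 0" using assms(3) sym by (auto simp: nondegenerate_def)
  have "v $ i = 0" if "i < ?g" for i
  proof -
    note d = linear_dual_basis[OF li, of i]
    have "dual_basis ?g (ibasis X) i y = (\<Sum>j<?g. v $ j * dual_basis ?g (ibasis X) i (ibasis X j))"
      by (simp add: y_def linear_sum[OF d] linear_cmul[OF d])
    also have "\<dots> = (\<Sum>j<?g. if j = i then v $ j else 0)"
      by (rule sum.cong) (auto simp: dual_basis_basis[OF li that])
    finally show ?thesis using \<open>y = 0\<close> linear_0[OF d] that by simp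
  qed
  then show False using v by (auto intro!: eq_vecI)
qed

section \<open>Poincare duality\<close>

lemma alt_shuffle_sum_param:
  assumes "\<And>a b. set a \<union> set b = set u \<Longrightarrow> alt M (\<lambda>s. m s a b)"
  shows "alt M (\<lambda>s. shuffle_sum (m s) u)"
proof (rule altI)
  fix p q x y assume *: "set p \<subseteq> M" "set q \<subseteq> M" "x \<in> M" "y \<in> M"
  show "shuffle_sum (m (p @ (x + y) # q)) u = shuffle_sum (m (p @ x # q)) u + shuffle_sum (m (p @ y # q)) u"
    unfolding shuffle_sum_add[symmetric]
    by (rule shuffle_sum_cong) (use * alt_add[OF assms] in simp)
next
  fix p q x assume *: "set p \<subseteq> M" "set q \<subseteq> M" "x \<in> M"
  show "shuffle_sum (m (p @ x # x # q)) u = 0"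
    by (rule shuffle_sum_eq_0) (use * alt_adjacent[OF assms] in simp)
qed

lemma alt_cmult_right: "alt M \<alpha> \<Longrightarrow> alt M (\<lambda>u. \<alpha> u * c)"
  using alt_cmult[of M \<alpha> c] by (simp add: mult.commute)

lemma alt_cup_left:
  assumes "\<And>v. alt M (\<lambda>u. \<omega> u v)" "\<And>v. alt M (\<lambda>u. \<xi> u v)"
    and "\<And>x y. x \<in> M \<Longrightarrow> y \<in> M \<Longrightarrow> x + y \<in> M"
  shows "alt M (\<lambda>u. cup \<omega> \<xi> u v)"
  unfolding cup_eq_shuffle_sum
  by (rule alt_shuffle_sum[OF _ _ assms(3)])
    (auto intro!: alt_shuffle_sum_param alt_cmult alt_cmult_right assms)

lemma alt_cup_right:
  assumes "\<And>u. alt M (\<omega> u)" "\<And>u. alt M (\<xi> u)"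
    and "\<And>x y. x \<in> M \<Longrightarrow> y \<in> M \<Longrightarrow> x + y \<in> M"
  shows "alt M (cup \<omega> \<xi> u)"
proof -
  have "alt M (\<lambda>v. shuffle_sum (\<lambda>c d. shuffle_sum (\<lambda>a b. \<omega> a c * \<xi> b d) u) v)"
    by (rule alt_shuffle_sum[OF _ _ assms(3)])
      (auto intro!: alt_shuffle_sum_param alt_cmult alt_cmult_right assms)
  moreover have "cup \<omega> \<xi> u = (\<lambda>v. shuffle_sum (\<lambda>c d. shuffle_sum (\<lambda>a b. \<omega> a c * \<xi> b d) u) v)"
    unfolding cup_eq_shuffle_sum by (intro ext shuffle_sum_commute)
  ultimately show ?thesis by simp
qed

lemma cohomology_iff:
  assumes "zgenerated g (pbasis Y) (periods Y)" "zgenerated g (ibasis Y) (integral Y)"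
  shows "\<omega> \<in> cohomology Y p q \<longleftrightarrow>
    (\<forall>u v. \<omega> u v \<in> \<rat>) \<and>
    (\<forall>u v. \<omega> u v \<noteq> 0 \<longrightarrow> set u \<subseteq> periods Y \<and> length u = q \<and> set v \<subseteq> integral Y \<and> length v = p) \<and>
    (\<forall>v. alt (periods Y) (\<lambda>u. \<omega> u v)) \<and> (\<forall>u. alt (integral Y) (\<omega> u))"
  unfolding cohomology_def
  by (simp add: alternating_on_iff_alt zgenerated_add[OF assms(1)] zgenerated_add[OF assms(2)] lists_eq_set)

text \<open>Truncation to one degree and extension by zero off the lattice preserve alternation, as
  its equations compare lists of equal length inside \<open>M\<close>.\<close>

lemma alt_restrict:
  assumes "alt M \<alpha>" "\<And>x y. x \<in> M \<Longrightarrow> y \<in> M \<Longrightarrow> x + y \<in> M"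
  shows "alt M (\<lambda>u. if set u \<subseteq> M \<and> length u = n \<and> P then \<alpha> u * c else 0)"
proof -
  have "alt M (\<lambda>u. (if length u = n \<and> P then c else 0) * \<alpha> u)"
    by (rule alt_length_mult[OF assms(1), of "\<lambda>l. if l = n \<and> P then c else 0"])
  then show ?thesis by (rule alt_cong[OF _ _ assms(2)]) simp
qed

text \<open>The test class \<open>y\<close> is the volume form \<open>\<tau>\<^sub>1\<close>,
  \<open>\<tau>\<^sub>2\<close> contracted with \<open>s\<close> and \<open>t\<close>. Applying
  \<open>wedge_contracted_top\<close> to each of the two lists returns \<open>x s t\<close>, so the
  Poincare pairing detects every value of \<open>x\<close>.\<close>

lemma poincare_eval:
  assumes zp: "zgenerated (tdim Y) (pbasis Y) (periods Y)"
    and zi: "zgenerated (tdim Y) (ibasis Y) (integral Y)"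
    and "alt (periods Y) \<tau>\<^sub>1" "\<tau>\<^sub>1 (map (pbasis Y) [0..<tdim Y]) = 1"
    and "alt (integral Y) \<tau>\<^sub>2" "\<tau>\<^sub>2 (map (ibasis Y) [0..<tdim Y]) = 1"
    and x: "x \<in> cohomology Y p q"
    and s: "set s \<subseteq> periods Y" "length s = q" and t: "set t \<subseteq> integral Y" "length t = p"
  defines "y \<equiv> \<lambda>u v. if set u \<subseteq> periods Y \<and> length u = tdim Y - q \<and>
      set v \<subseteq> integral Y \<and> length v = tdim Y - p then \<tau>\<^sub>1 (s @ u) * \<tau>\<^sub>2 (t @ v) else 0"
  shows "poincare Y x y = (-1) ^ (q * (tdim Y - q)) * (-1) ^ (p * (tdim Y - p)) * x s t"
proof -
  let ?g = "tdim Y"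
  let ?B1 = "map (pbasis Y) [0..<?g]" and ?B2 = "map (ibasis Y) [0..<?g]"
  let ?e1 = "(-1) ^ (q * (?g - q)) :: real" and ?e2 = "(-1) ^ (p * (?g - p)) :: real"
  have x1: "\<And>v. alt (periods Y) (\<lambda>u. x u v)" and x2: "\<And>u. alt (integral Y) (x u)"
    and x0: "\<And>u v. x u v \<noteq> 0 \<Longrightarrow> set u \<subseteq> periods Y \<and> length u = q \<and> set v \<subseteq> integral Y \<and> length v = p"
    using x unfolding cohomology_iff[OF zp zi] by blast+
  have B1: "set ?B1 \<subseteq> periods Y" and B2: "set ?B2 \<subseteq> integral Y"
    using zgenerated_basis[OF zp] zgenerated_basis[OF zi] by auto
  have "poincare Y x y = shuffle_sum (\<lambda>a b. shuffle_sum (\<lambda>c d. y a c * x b d) ?B2) ?B1"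
    by (simp add: poincare_def delta_def cup_eq_shuffle_sum)
  \<comment> \<open>The factor \<open>x\<close> is brought to the front, where
    \<open>wedge_contracted_top\<close> expects it. Each of the two lists yields one of the signs in
    the claim.\<close>
  also have "\<dots> = shuffle_sum (\<lambda>a b. (-1) ^ (length a * length b) *
      shuffle_sum (\<lambda>c d. y b c * x a d) ?B2) ?B1"
    by (rule shuffle_sum_swap)
  also have "\<dots> = shuffle_sum (\<lambda>a b. (-1) ^ (length a * length b) *
      shuffle_sum (\<lambda>c d. (-1) ^ (length c * length d) * (y b d * x a c)) ?B2) ?B1"
    by (subst shuffle_sum_swap) simp
  also have "\<dots> = shuffle_sum (\<lambda>a b. shuffle_sum (\<lambda>c d. (-1) ^ (length a * length b) *
      ((-1) ^ (length c * length d) * (y b d * x a c))) ?B2) ?B1"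
    unfolding shuffle_sum_cmult ..
  also have "\<dots> = shuffle_sum (\<lambda>a b. shuffle_sum (\<lambda>c d.
      (?e1 * ?e2) * (x a c * \<tau>\<^sub>2 (t @ d) * \<tau>\<^sub>1 (s @ b))) ?B2) ?B1"
  proof (intro shuffle_sum_cong)
    fix a b c d
    assume *: "set a \<union> set b = set ?B1" "length a + length b = length ?B1"
      "set c \<union> set d = set ?B2" "length c + length d = length ?B2"
    show "(-1) ^ (length a * length b) * ((-1) ^ (length c * length d) * (y b d * x a c)) =
        (?e1 * ?e2) * (x a c * \<tau>\<^sub>2 (t @ d) * \<tau>\<^sub>1 (s @ b))"
    proof (cases "x a c = 0")
      case False
      then have "length a = q" "length c = p" using x0 by blast+
      moreover have "set b \<subseteq> periods Y" "set d \<subseteq> integral Y" using * B1 B2 by blast+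
      moreover have "length b = ?g - q" "length d = ?g - p" using * calculation by auto
      ultimately show ?thesis by (simp add: y_def)
    qed simp
  qed
  also have "\<dots> = (?e1 * ?e2) * shuffle_sum (\<lambda>a b. shuffle_sum (\<lambda>c d.
      x a c * \<tau>\<^sub>2 (t @ d)) ?B2 * \<tau>\<^sub>1 (s @ b)) ?B1"
    unfolding shuffle_sum_cmult shuffle_sum_cmult_right ..
  also have "\<dots> = (?e1 * ?e2) * shuffle_sum (\<lambda>a b. x a t * \<tau>\<^sub>1 (s @ b)) ?B1"
  proof -
    have "x a u = 0" if "length u \<noteq> length t" for a u using that x0 t by blast
    then have "shuffle_sum (\<lambda>c d. x a c * \<tau>\<^sub>2 (t @ d)) ?B2 = x a t" for a
      using wedge_contracted_top[OF zi assms(5) x2 t(1) B2, of a] assms(6) by simp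
    then show ?thesis by simp
  qed
  also have "shuffle_sum (\<lambda>a b. x a t * \<tau>\<^sub>1 (s @ b)) ?B1 = x s t"
  proof -
    have "x u t = 0" if "length u \<noteq> length s" for u using that x0 s by blast
    then show ?thesis
      using wedge_contracted_top[OF zp assms(3) x1 s(1) B1, of t] assms(4) by simp
  qed
  finally show ?thesis .
qed

text \<open>Two candidates have equal pairings with all test classes of \<open>poincare_eval\<close>
  and so agree on all arguments. Rational values of the volume forms are required for the test
  classes to be cohomology classes.\<close>

lemma poincare_inv_eqI:
  assumes zp: "zgenerated (tdim Y) (pbasis Y) (periods Y)"
    and zi: "zgenerated (tdim Y) (ibasis Y) (integral Y)"
    and "alt (periods Y) \<tau>\<^sub>1" "\<tau>\<^sub>1 (map (pbasis Y) [0..<tdim Y]) = 1"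
    and Q1: "\<And>u. set u \<subseteq> periods Y \<Longrightarrow> \<tau>\<^sub>1 u \<in> \<rat>"
    and "alt (integral Y) \<tau>\<^sub>2" "\<tau>\<^sub>2 (map (ibasis Y) [0..<tdim Y]) = 1"
    and Q2: "\<And>u. set u \<subseteq> integral Y \<Longrightarrow> \<tau>\<^sub>2 u \<in> \<rat>"
    and x: "x \<in> cohomology Y p q"
    and eq: "\<And>y. y \<in> cohomology Y (tdim Y - p) (tdim Y - q) \<Longrightarrow> poincare Y x y = z y"
  shows "poincare_inv Y p q z = x"
  unfolding poincare_inv_def
proof (rule the_equality)
  show "x \<in> cohomology Y p q \<and> (\<forall>y\<in>cohomology Y (tdim Y - p) (tdim Y - q). poincare Y x y = z y)"
    using x eq by blast
next
  fix x' assume x': "x' \<in> cohomology Y p q \<and>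
    (\<forall>y\<in>cohomology Y (tdim Y - p) (tdim Y - q). poincare Y x' y = z y)"
  show "x' = x"
  proof (intro ext)
    fix s t
    show "x' s t = x s t"
    proof (cases "set s \<subseteq> periods Y \<and> length s = q \<and> set t \<subseteq> integral Y \<and> length t = p")
      case True
      let ?y = "\<lambda>u v. if set u \<subseteq> periods Y \<and> length u = tdim Y - q \<and>
        set v \<subseteq> integral Y \<and> length v = tdim Y - p then \<tau>\<^sub>1 (s @ u) * \<tau>\<^sub>2 (t @ v) else 0"
      have "alt (periods Y) (\<lambda>u. \<tau>\<^sub>1 (s @ u))" "alt (integral Y) (\<lambda>v. \<tau>\<^sub>2 (t @ v))"
        using True assms by (auto intro: alt_append)
      note r = alt_restrict[OF this(1) zgenerated_add[OF zp]] alt_restrict[OF this(2) zgenerated_add[OF zi]]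
      have "?y \<in> cohomology Y (tdim Y - p) (tdim Y - q)"
        unfolding cohomology_iff[OF zp zi]
      proof (intro conjI allI)
        show "?y u v \<in> \<rat>" for u v using True by (auto intro!: Rats_mult Q1 Q2)
        show "alt (periods Y) (\<lambda>u. ?y u v)" for v
          using r(1)[of _ "set v \<subseteq> integral Y \<and> length v = tdim Y - p" "\<tau>\<^sub>2 (t @ v)"] by simp
        show "alt (integral Y) (?y u)" for u
        proof -
          have "?y u = (\<lambda>v. if set v \<subseteq> integral Y \<and> length v = tdim Y - p \<and>
              set u \<subseteq> periods Y \<and> length u = tdim Y - q then \<tau>\<^sub>2 (t @ v) * \<tau>\<^sub>1 (s @ u) else 0)"
            by (intro ext) auto
          then show ?thesis
            using r(2)[of "tdim Y - p" "set u \<subseteq> periods Y \<and> length u = tdim Y - q" "\<tau>\<^sub>1 (s @ u)"]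
            by (simp only:)
        qed
      qed auto
      then have "poincare Y x' ?y = poincare Y x ?y" using x' eq by simp
      moreover note poincare_eval[OF zp zi assms(3,4,6,7) x, of s t]
        poincare_eval[OF zp zi assms(3,4,6,7) conjunct1[OF x'], of s t]
      ultimately show ?thesis using True by simp
    next
      case False
      then show ?thesis
        using x conjunct1[OF x'] unfolding cohomology_iff[OF zp zi] by metis
    qed
  qed
qed

section \<open>The Fourier--Mukai transform of a Chern class\<close>

locale nondegenerate_bundle =
  fixes X :: "'v::real_vector torus" and L :: "'v line_bundle" and g p k :: nat
  assumes torus: "real_torus X" and dim: "tdim X = g"
    and tropical: "tropical_line_bundle X L" and nondeg: "nondegenerate L"
    and degree: "p + k = g"
begin

abbreviation "E \<equiv> chern L"
abbreviation "pers \<equiv> map (pbasis X) [0..<g]"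
abbreviation "ints \<equiv> map (ibasis X) [0..<g]"
abbreviation "chern_power n \<equiv> scale (1 / fact n) (cup_power (c1 X L) n)"

lemma lattice_periods: "lattice_basis g (pbasis X) (periods X)"
  and lattice_integral: "lattice_basis g (ibasis X) (integral X)"
  using torus dim by (auto simp: real_torus_def)

lemmas lattices = lattice_periods[folded dim] lattice_integral[folded dim]

lemma E_add_left: "E (x + y) z = E x z + E y z"
  and E_add_right: "E z (x + y) = E z x + E z y"
  and E_sym: "E x y = E y x"
  using tropical linear_add[of "\<lambda>x. E x z"] linear_add[of "E z"]
  by (simp_all add: tropical_line_bundle_def)

lemma minor_E_sym: "minor E u v = minor E v u"
proof -
  have "minor (\<lambda>x y. E y x) v u = minor E v u" by (rule minor_cong) (rule E_sym)
  then show ?thesis using minor_transpose[of E u v] by simp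
qed

lemma zgenerated_periods: "zgenerated g (pbasis X) (periods X)"
  and zgenerated_integral: "zgenerated g (ibasis X) (integral X)"
  by (rule zgenerated_lattice lattice_periods lattice_integral)+

lemma zgenerated_dual:
  "zgenerated (tdim (dual_torus X)) (pbasis (dual_torus X)) (periods (dual_torus X))"
  "zgenerated (tdim (dual_torus X)) (ibasis (dual_torus X)) (integral (dual_torus X))"
  using zgenerated_dual_lattice lattice_periods lattice_integral dim by (auto simp: dual_torus_def)

lemma det_chern_eq_minor: "det_chern X L = minor E pers ints"
proof -
  have "mat g g (\<lambda>(i, j). E (pbasis X i) (ibasis X j)) = mat g g (\<lambda>(i, j). E (pers ! i) (ints ! j))"
    by (rule eq_matI) auto
  then show ?thesis by (simp add: det_chern_def dim minor_eq_det[where n = g])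
qed

lemma det_chern_Ints: "det_chern X L \<in> \<int>"
  unfolding det_chern_eq_minor
proof (rule minor_Ints)
  fix x y assume "x \<in> set pers" "y \<in> set ints"
  then have "x \<in> periods X" "y \<in> integral X"
    using zgenerated_basis[OF zgenerated_periods] zgenerated_basis[OF zgenerated_integral] by auto
  then show "E x y \<in> \<int>" using tropical by (simp add: tropical_line_bundle_def)
qed

lemma chern_power_eq:
  "chern_power n u v =
    (if length u = n \<and> set u \<subseteq> periods X \<and> set v \<subseteq> integral X then minor E u v else 0)"
  by (simp add: scale_def cup_power_c1[OF E_add_left])

text \<open>The unsigned double shuffle sum, with \<open>delta\<close> already evaluated on the
  bases of \<open>X\<close>. The list \<open>s\<close> is paired with vectors of N because the
  periods of the dual torus are functionals on N; likewise \<open>t\<close> with vectors of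
  \<Lambda>.\<close>

definition transform :: "('v \<Rightarrow> real) list \<Rightarrow> ('v \<Rightarrow> real) list \<Rightarrow> real" where
  "transform s t = shuffle_sum (\<lambda>a b. shuffle_sum (\<lambda>c d.
     pairing_minor t a * pairing_minor s c * minor E b d) ints) pers"

definition transform_class :: "('v \<Rightarrow> real) form" where
  "transform_class s t =
    (if set s \<subseteq> dual_lattice (integral X) \<and> length s = k \<and>
        set t \<subseteq> dual_lattice (periods X) \<and> length t = k then transform s t else 0)"

lemma fourier_mukai_eq_transform:
  "fourier_mukai X (chern_power p) = scale ((-1) ^ k) transform_class"
proof (intro ext)
  fix s t
  let ?in = "set s \<subseteq> dual_lattice (integral X) \<and> set t \<subseteq> dual_lattice (periods X)"
  let ?len = "length s = k \<and> length t = k"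
  let ?W = pairing_minor
  have "fourier_mukai X (chern_power p) s t = shuffle_sum (\<lambda>a b. shuffle_sum (\<lambda>c d.
      kexp (c1_poincare X) a c s t * chern_power p b d) ints) pers"
    by (simp add: fourier_mukai_eq_cup delta_def dim cup_eq_shuffle_sum)
  also have "\<dots> = shuffle_sum (\<lambda>a b. shuffle_sum (\<lambda>c d.
      (if ?in \<and> ?len then (-1) ^ k else 0) * (?W t a * ?W s c * minor E b d)) ints) pers"
  proof (intro shuffle_sum_cong)
    fix a b c d
    assume *: "set a \<union> set b = set pers" "length a + length b = length pers"
      "set c \<union> set d = set ints" "length c + length d = length ints"
    then have sub: "set a \<subseteq> periods X" "set b \<subseteq> periods X" "set c \<subseteq> integral X" "set d \<subseteq> integral X"
      using zgenerated_basis[OF zgenerated_periods] zgenerated_basis[OF zgenerated_integral] by blast+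
    have len: "length a + length b = p + k" "length c + length d = p + k" using * degree by auto
    let ?n = "length a + length c"
    have lhs: "kexp (c1_poincare X) a c s t * chern_power p b d =
        (if ?in then (-1) ^ (?n * (?n + 1) div 2) * (?W s c * ?W t a) else 0) *
        (if length b = p then minor E b d else 0)"
      unfolding kexp_c1_poincare[OF lattices] chern_power_eq using sub by simp
    show "kexp (c1_poincare X) a c s t * chern_power p b d =
        (if ?in \<and> ?len then (-1) ^ k else 0) * (?W t a * ?W s c * minor E b d)"
    \<comment> \<open>Otherwise one of the three minors vanishes. Together with
      \<open>length b = p\<close> these equalities force \<open>a\<close>, \<open>c\<close>,
      \<open>s\<close> and \<open>t\<close> to have length \<open>k\<close>.\<close>
    proof (cases "length t = length a \<and> length s = length c \<and> length b = length d")
      case True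
      show ?thesis
      proof (cases "length b = p")
        case b: True
        then have "length a = k" "length c = k" using True len by auto
        \<comment> \<open>The exponent of the sign in degree \<open>2k\<close> is k(2k+1), of the
          same parity as \<open>k\<close>.\<close>
        moreover have "(k + k) * (k + k + 1) div 2 = k + 2 * (k * k)"
        proof -
          have "(k + k) * (k + k + 1) = (k + 2 * (k * k)) * 2" by (simp add: algebra_simps)
          then show ?thesis by (simp only: nonzero_mult_div_cancel_right zero_neq_numeral not_False_eq_True)
        qed
        ultimately show ?thesis using True b unfolding lhs by (simp add: power_add)
      next
        case False
        then have "length a \<noteq> k" using len by auto
        with False True show ?thesis unfolding lhs by auto
      qed
    next
      case False
      then have "?W t a = 0 \<or> ?W s c = 0 \<or> minor E b d = 0"
        using minor_length[of t a "\<lambda>f x. f x"] minor_length[of s c "\<lambda>f x. f x"] minor_length[of b d E]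
        by blast
      then show ?thesis unfolding lhs by auto
    qed
  qed
  also have "\<dots> = (if ?in \<and> ?len then (-1) ^ k else 0) * transform s t"
    unfolding shuffle_sum_cmult transform_def ..
  also have "\<dots> = scale ((-1) ^ k) transform_class s t"
    by (simp add: scale_def transform_class_def)
  finally show "fourier_mukai X (chern_power p) s t = scale ((-1) ^ k) transform_class s t" .
qed

text \<open>Evaluation at a vector is additive on arbitrary functions, so alternation holds over any
  set \<open>M\<close>.\<close>

lemma alt_transform_left: "alt M (\<lambda>s. transform s t)"
  and alt_transform_right: "alt M (transform s)"
proof -
  have W: "alt M (\<lambda>s. pairing_minor s v)" for v :: "'v list"
    by (rule alt_minor_left) simp
  show "alt M (\<lambda>s. transform s t)"
    unfolding transform_def by (intro alt_shuffle_sum_param alt_cmult_right alt_cmult W)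
  have "alt M (\<lambda>t. transform s t)"
    unfolding transform_def by (intro alt_shuffle_sum_param alt_cmult_right W)
  then show "alt M (transform s)" by simp
qed

lemma transform_class_Ints: "transform_class s t \<in> \<int>"
proof -
  have B: "set pers \<subseteq> periods X" "set ints \<subseteq> integral X"
    using zgenerated_basis[OF zgenerated_periods] zgenerated_basis[OF zgenerated_integral] by auto
  have "transform s t \<in> \<int>"
    if "set s \<subseteq> dual_lattice (integral X)" "set t \<subseteq> dual_lattice (periods X)"
    unfolding transform_def
  proof (intro shuffle_sum_Ints Ints_mult minor_Ints)
    fix a b c d assume *: "set a \<subseteq> set pers" "set b \<subseteq> set pers" "set c \<subseteq> set ints" "set d \<subseteq> set ints"
    show "f x \<in> \<int>" if "f \<in> set t" "x \<in> set a" for f x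
      using that * B \<open>set t \<subseteq> _\<close> by (meson dual_lattice_Ints subsetD)
    show "f x \<in> \<int>" if "f \<in> set s" "x \<in> set c" for f x
      using that * B \<open>set s \<subseteq> _\<close> by (meson dual_lattice_Ints subsetD)
    show "E x y \<in> \<int>" if "x \<in> set b" "y \<in> set d" for x y
      using that * B tropical unfolding tropical_line_bundle_def by (meson subsetD)
  qed
  then show ?thesis by (simp add: transform_class_def)
qed

text \<open>Used for two multiples: by det E for the pushforward and by (-1)^k for the
  transform.\<close>

lemma transform_class_cohomology:
  assumes "r \<in> \<int>"
  shows "scale r transform_class \<in> cohomology (dual_torus X) k k"
  unfolding cohomology_iff[OF zgenerated_dual]
proof (intro conjI allI)
  let ?N = "dual_lattice (integral X)" and ?L = "dual_lattice (periods X)"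
  have dt: "periods (dual_torus X) = ?N" "integral (dual_torus X) = ?L"
    by (simp_all add: dual_torus_def)
  note add = zgenerated_add[OF zgenerated_dual(1), unfolded dt] zgenerated_add[OF zgenerated_dual(2), unfolded dt]
  show "scale r transform_class u v \<in> \<rat>" for u v
    using assms transform_class_Ints[of u v] Ints_subset_Rats by (auto simp: scale_def)
  show "scale r transform_class u v \<noteq> 0 \<longrightarrow> set u \<subseteq> periods (dual_torus X) \<and> length u = k \<and>
      set v \<subseteq> integral (dual_torus X) \<and> length v = k" for u v
    unfolding dt by (simp add: scale_def transform_class_def)
  show "alt (periods (dual_torus X)) (\<lambda>u. scale r transform_class u v)" for v
  proof -
    have "(\<lambda>u. scale r transform_class u v) =
        (\<lambda>u. if set u \<subseteq> ?N \<and> length u = k \<and> set v \<subseteq> ?L \<and> length v = k then transform u v * r else 0)"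
      by (rule ext) (simp add: scale_def transform_class_def)
    then show ?thesis unfolding dt using alt_restrict[OF alt_transform_left add(1)] by (simp only:)
  qed
  show "alt (integral (dual_torus X)) (scale r transform_class u)" for u
  proof -
    have "scale r transform_class u =
        (\<lambda>v. if set v \<subseteq> ?L \<and> length v = k \<and> set u \<subseteq> ?N \<and> length u = k then transform u v * r else 0)"
      by (rule ext) (auto simp: scale_def transform_class_def)
    then show ?thesis unfolding dt using alt_restrict[OF alt_transform_right add(2)] by (simp only:)
  qed
qed

section \<open>Evaluation on images under the homomorphism\<close>

abbreviation "\<Phi> \<equiv> phi_lift L"

text \<open>Integrality of E is given for \<Lambda> in the first argument and N in the second;
  symmetry supplies the other order.\<close>

lemma phi_lift_periods: "x \<in> periods X \<Longrightarrow> \<Phi> x \<in> dual_lattice (integral X)"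
  and phi_lift_integral: "x \<in> integral X \<Longrightarrow> \<Phi> x \<in> dual_lattice (periods X)"
proof -
  have "linear (\<lambda>y. - E y x)"
    using tropical by (intro linear_compose_neg) (simp add: tropical_line_bundle_def)
  moreover have "- E y x \<in> \<int>" if "x \<in> periods X \<and> y \<in> integral X \<or> y \<in> periods X \<and> x \<in> integral X" for y
    using that tropical E_sym[of x y] by (auto simp: tropical_line_bundle_def)
  ultimately show "x \<in> periods X \<Longrightarrow> \<Phi> x \<in> dual_lattice (integral X)"
    "x \<in> integral X \<Longrightarrow> \<Phi> x \<in> dual_lattice (periods X)"
    unfolding dual_lattice_def phi_lift_eq by blast+
qed

lemma pairing_minor_phi: "pairing_minor (map \<Phi> u) v = (-1) ^ length u * minor E u v"
proof -
  have "pairing_minor (map \<Phi> u) v = minor (\<lambda>x y. - E x y) u v"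
    unfolding minor_map_left by (rule minor_cong) (simp add: phi_lift_eq E_sym)
  then show ?thesis by (simp add: minor_uminus)
qed

text \<open>Laplace expansion along \<open>u\<close> turns the sum over \<open>\<eta>\<close> into \<open>det E(u \<union> b, \<eta>)\<close>, a top form.\<close>

lemma transform_phi:
  assumes "set u \<subseteq> periods X" "set v \<subseteq> integral X" "length u = k" "length v = k"
  shows "transform (map \<Phi> u) (map \<Phi> v) = det_chern X L * minor E u v"
proof -
  have "transform (map \<Phi> u) (map \<Phi> v) =
      shuffle_sum (\<lambda>a b. shuffle_sum (\<lambda>c d. minor E v a * (minor E u c * minor E b d)) ints) pers"
    \<comment> \<open>The two signs (-1)^k, one from each pairing, cancel.\<close>
    unfolding transform_def pairing_minor_phi assms(3,4) by (simp add: mult_ac)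
  also have "\<dots> = shuffle_sum (\<lambda>a b. minor E v a * minor E (u @ b) ints) pers"
    unfolding shuffle_sum_cmult minor_append ..
  also have "\<dots> = minor E v u * minor E pers ints"
  \<comment> \<open>The form \<open>minor E v\<close> is wedged with the contraction by
    \<open>u\<close> of the top form \<open>minor E _ ints\<close>, and so is evaluated at
    \<open>u\<close>.\<close>
  proof (rule wedge_contracted_top[OF zgenerated_periods])
    show "alt (periods X) (\<lambda>u. minor E u ints)" by (rule alt_minor_left) (rule E_add_left)
    show "alt (periods X) (minor E v)"
      by (rule alt_minor_right) (auto simp: E_add_right zgenerated_add[OF zgenerated_periods])
    show "set pers \<subseteq> periods X" by (rule zgenerated_basis[OF zgenerated_periods])
    show "minor E v w = 0" if "length w \<noteq> length u" for w
      using that assms by (intro minor_length) simp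
  qed (use assms in auto)
  finally show ?thesis by (simp add: det_chern_eq_minor minor_E_sym[of v u] mult.commute)
qed

text \<open>Both sides are evaluated on \<open>\<Phi>(\<lambda>)\<close>, \<open>\<Phi>(\<eta>)\<close>, where a top form on the dual torus takes
  \<open>(det E)\<^sup>2\<close> times its value on the dual bases.\<close>

lemma poincare_transform:
  assumes y: "y \<in> cohomology (dual_torus X) (tdim (dual_torus X) - k) (tdim (dual_torus X) - k)"
  shows "poincare (dual_torus X) (scale (det_chern X L) transform_class) y =
    homology_push X \<Phi> (poincare X (chern_power k)) y"
proof -
  let ?c = "det_chern X L"
  let ?z = "scale ?c transform_class"
  let ?N = "dual_lattice (integral X)" and ?L = "dual_lattice (periods X)"
  let ?B1 = "map (dual_basis g (ibasis X)) [0..<g]" and ?B2 = "map (dual_basis g (pbasis X)) [0..<g]"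
  have dt: "periods (dual_torus X) = ?N" "integral (dual_torus X) = ?L" "tdim (dual_torus X) = g"
    "pbasis (dual_torus X) = dual_basis g (ibasis X)" "ibasis (dual_torus X) = dual_basis g (pbasis X)"
    by (simp_all add: dual_torus_def dim)
  note zd = zgenerated_dual[unfolded dt]
  have B: "set pers \<subseteq> periods X" "set ints \<subseteq> integral X"
    using zgenerated_basis[OF zgenerated_periods] zgenerated_basis[OF zgenerated_integral] by auto
  have PhiB: "set (map \<Phi> pers) \<subseteq> ?N" "set (map \<Phi> ints) \<subseteq> ?L"
    using B phi_lift_periods phi_lift_integral by auto
  have yalt: "\<And>v. alt ?N (\<lambda>u. y u v)" "\<And>u. alt ?L (y u)"
    using y unfolding cohomology_iff[OF zgenerated_dual] unfolding dt by blast+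
  have zalt: "\<And>v. alt ?N (\<lambda>u. ?z u v)" "\<And>u. alt ?L (?z u)"
    using transform_class_cohomology[OF det_chern_Ints]
    unfolding cohomology_iff[OF zgenerated_dual] unfolding dt by blast+
  have W: "alt M (\<lambda>s. pairing_minor s v)" for M and v :: "'v list"
    by (rule alt_minor_left) simp
  \<comment> \<open>The reference top form is pairing with \<open>ints\<close>: it is 1 on the dual
    basis and (-1)^g det E on the images. The second list is treated alike with \<open>pers\<close>,
    and the two signs (-1)^g cancel.\<close>
  have "cup y ?z (map \<Phi> pers) (map \<Phi> ints) * pairing_minor ?B1 ints =
      pairing_minor (map \<Phi> pers) ints * cup y ?z ?B1 (map \<Phi> ints)"
    by (rule alt_top_proportional[OF zd(1) alt_cup_left[OF yalt(1) zalt(1) zgenerated_add[OF zd(1)]] W])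
      (use PhiB in auto)
  then have 1: "cup y ?z (map \<Phi> pers) (map \<Phi> ints) = (-1) ^ g * ?c * cup y ?z ?B1 (map \<Phi> ints)"
    by (simp only: pairing_minor_dual_basis[OF lattice_integral] pairing_minor_phi det_chern_eq_minor) simp
  have "cup y ?z ?B1 (map \<Phi> ints) * pairing_minor ?B2 pers =
      pairing_minor (map \<Phi> ints) pers * cup y ?z ?B1 ?B2"
    by (rule alt_top_proportional[OF zd(2) alt_cup_right[OF yalt(2) zalt(2) zgenerated_add[OF zd(2)]] W])
      (use PhiB in auto)
  then have 2: "cup y ?z ?B1 (map \<Phi> ints) = (-1) ^ g * ?c * cup y ?z ?B1 ?B2"
    by (simp only: pairing_minor_dual_basis[OF lattice_periods] pairing_minor_phi det_chern_eq_minor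
        minor_E_sym[of ints]) simp
  have "cup y ?z (map \<Phi> pers) (map \<Phi> ints) =
      shuffle_sum (\<lambda>a b. shuffle_sum (\<lambda>c d.
        y (map \<Phi> a) (map \<Phi> c) * ?z (map \<Phi> b) (map \<Phi> d)) ints) pers"
    unfolding cup_eq_shuffle_sum shuffle_sum_map ..
  also have "\<dots> = shuffle_sum (\<lambda>a b. shuffle_sum (\<lambda>c d.
        (?c * ?c) * (pullback X \<Phi> y a c * chern_power k b d)) ints) pers"
  proof (intro shuffle_sum_cong)
    fix a b c d
    assume "set a \<union> set b = set pers" "set c \<union> set d = set ints"
    then have sub: "set a \<subseteq> periods X" "set b \<subseteq> periods X" "set c \<subseteq> integral X" "set d \<subseteq> integral X"
      using B by blast+
    then have "pullback X \<Phi> y a c = y (map \<Phi> a) (map \<Phi> c)"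
      by (simp add: pullback_def lists_eq_set)
    \<comment> \<open>One factor det E is part of \<open>?z\<close>, the other comes from
      \<open>transform_phi\<close>; they balance the two factors produced in top degree.\<close>
    moreover have "?z (map \<Phi> b) (map \<Phi> d) = ?c * ?c * chern_power k b d"
    proof (cases "length b = k \<and> length d = k")
      case True
      moreover have "set (map \<Phi> b) \<subseteq> ?N" "set (map \<Phi> d) \<subseteq> ?L"
        using sub phi_lift_periods phi_lift_integral by auto
      ultimately have "transform_class (map \<Phi> b) (map \<Phi> d) = ?c * minor E b d"
        using sub transform_phi[of b d] unfolding transform_class_def by simp
      then show ?thesis using True sub by (simp add: scale_def[of ?c] chern_power_eq)
    next
      case False
      then show ?thesis
        using minor_length[of b d E]
        by (auto simp: scale_def[of ?c] transform_class_def chern_power_eq)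
    qed
    ultimately show "y (map \<Phi> a) (map \<Phi> c) * ?z (map \<Phi> b) (map \<Phi> d) =
        (?c * ?c) * (pullback X \<Phi> y a c * chern_power k b d)"
      by simp
  qed
  also have "\<dots> = (?c * ?c) * delta X (cup (pullback X \<Phi> y) (chern_power k))"
    unfolding shuffle_sum_cmult by (simp add: delta_def cup_eq_shuffle_sum dim)
  finally have "(?c * ?c) * delta X (cup (pullback X \<Phi> y) (chern_power k)) =
      (-1) ^ g * ?c * ((-1) ^ g * ?c * cup y ?z ?B1 ?B2)"
    unfolding 1 2 by (rule sym)
  also have "\<dots> = (?c * ?c) * ((-1) ^ g * (-1) ^ g * cup y ?z ?B1 ?B2)"
    by (simp only: mult_ac)
  also have "(-1) ^ g * (-1) ^ g * cup y ?z ?B1 ?B2 = cup y ?z ?B1 ?B2"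
    by (simp flip: power_mult_distrib)
  \<comment> \<open>Nondegeneracy enters here, since the square of det E is cancelled.\<close>
  finally have "delta X (cup (pullback X \<Phi> y) (chern_power k)) = cup y ?z ?B1 ?B2"
    using det_chern_nonzero[OF torus tropical nondeg] by (metis mult_left_cancel mult_eq_0_iff)
  then show ?thesis
    by (simp add: poincare_def homology_push_def delta_def dt)
qed

text \<open>Uniqueness is applied with the pairings against \<open>ints\<close> and
  \<open>pers\<close> as volume forms; they are integral on the dual lattices and normalised on the
  dual bases.\<close>

lemma phi_push_chern_power:
  "phi_push X L k k (chern_power k) = scale (det_chern X L) transform_class"
  unfolding phi_push_def
proof (rule poincare_inv_eqI[OF zgenerated_dual,
      where \<tau>\<^sub>1 = "\<lambda>s. pairing_minor s ints" and \<tau>\<^sub>2 = "\<lambda>t. pairing_minor t pers"])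
  have W: "alt M (\<lambda>s. pairing_minor s v)" for M and v :: "'v list"
    by (rule alt_minor_left) simp
  show "alt (periods (dual_torus X)) (\<lambda>s. pairing_minor s ints)"
    "alt (integral (dual_torus X)) (\<lambda>t. pairing_minor t pers)"
    by (rule W)+
  show "pairing_minor (map (pbasis (dual_torus X)) [0..<tdim (dual_torus X)]) ints = 1"
    "pairing_minor (map (ibasis (dual_torus X)) [0..<tdim (dual_torus X)]) pers = 1"
    using pairing_minor_dual_basis[OF lattice_integral] pairing_minor_dual_basis[OF lattice_periods]
    by (simp_all add: dual_torus_def dim)
  have B: "set pers \<subseteq> periods X" "set ints \<subseteq> integral X"
    using zgenerated_basis[OF zgenerated_periods] zgenerated_basis[OF zgenerated_integral] by auto
  show "pairing_minor u ints \<in> \<rat>" if "set u \<subseteq> periods (dual_torus X)" for u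
  proof (intro subsetD[OF Ints_subset_Rats] minor_Ints)
    fix f x assume "f \<in> set u" "x \<in> set ints"
    with that B(2) have "f \<in> dual_lattice (integral X)" "x \<in> integral X" by (auto simp: dual_torus_def)
    then show "f x \<in> \<int>" by (rule dual_lattice_Ints)
  qed
  show "pairing_minor u pers \<in> \<rat>" if "set u \<subseteq> integral (dual_torus X)" for u
  proof (intro subsetD[OF Ints_subset_Rats] minor_Ints)
    fix f x assume "f \<in> set u" "x \<in> set pers"
    with that B(1) have "f \<in> dual_lattice (periods X)" "x \<in> periods X" by (auto simp: dual_torus_def)
    then show "f x \<in> \<int>" by (rule dual_lattice_Ints)
  qed
qed (use transform_class_cohomology[OF det_chern_Ints] poincare_transform in auto)

end

theorem theoremB:
  fixes X :: "'v::real_vector torus" and L :: "'v line_bundle" and g p :: nat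
  assumes "real_torus X" and "tdim X = g"
    and "tropical_line_bundle X L" and "nondegenerate L"
    and "p \<le> g"
  shows "fourier_mukai X (scale (1 / fact p) (cup_power (c1 X L) p))
           \<in> cohomology (dual_torus X) (g - p) (g - p) \<and>
         fourier_mukai X (scale (1 / fact p) (cup_power (c1 X L) p)) =
           scale ((-1) ^ (g - p) / det_chern X L)
             (phi_push X L (g - p) (g - p)
               (scale (1 / fact (g - p)) (cup_power (c1 X L) (g - p))))"
proof -
  interpret nondegenerate_bundle X L g p "g - p"
    by unfold_locales (use assms in auto)
  have "scale ((-1) ^ (g - p) / det_chern X L) (scale (det_chern X L) transform_class) =
      scale ((-1) ^ (g - p)) transform_class"
    using det_chern_nonzero[OF assms(1,3,4)] by (intro ext) (simp add: scale_def)
  then show ?thesis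
    unfolding fourier_mukai_eq_transform phi_push_chern_power
    by (simp add: transform_class_cohomology)
qed

end
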